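(* There exists a distance-approximation algorithm for induced $C_4$-freeness whose query complexity is $\exp(\mathrm{poly}(1/\varepsilon))$.
   Context: Graphs are finite, simple and undirected; the input graph $G=(V,E)$ has $n=|V|$ vertices. The distance between two graphs $G=(V,E)$ and $G'=(V,E')$ is $\Delta(G,G')=(|E\setminus E'|+|E'\setminus E|)/n^2$, and for a graph property $\mathcal{P}$, $\Delta(G,\mathcal{P})=\min_{G'\in\mathcal{P}}\Delta(G,G')$. A distance-approximation algorithm for $\mathcal{P}$ is a randomized algorithm that, for every graph $G$ and every $\varepsilon\in(0,1)$, given $\varepsilon$ and query access to the adjacency matrix of $G$, outputs $\hat\Delta$ with $|\hat\Delta-\Delta(G,\mathcal{P})|\le\varepsilon$ with probability at least $2/3$; its query complexity is the number of adjacency queries. $C_4$ is the cycle on $4$ vertices; induced $C_4$-free means no induced subgraph is isomorphic to $C_4$. *)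

theory Defs
  imports "HOL-Probability.Probability" "HOL-Computational_Algebra.Polynomial"
begin

text \<open>A graph is a pair of a vertex set and a set of edges, an edge being a two-element vertex set.\<close>

type_synonym 'a ugraph = "'a set \<times> 'a set set"

abbreviation verts :: "'a ugraph \<Rightarrow> 'a set" where
  "verts G \<equiv> fst G"

abbreviation edges :: "'a ugraph \<Rightarrow> 'a set set" where
  "edges G \<equiv> snd G"

definition simple_graph :: "'a ugraph \<Rightarrow> bool" where
  "simple_graph G \<longleftrightarrow> finite (verts G) \<and> (\<forall>e\<in>edges G. e \<subseteq> verts G \<and> card e = 2)"

definition graph_iso :: "'a ugraph \<Rightarrow> 'b ugraph \<Rightarrow> bool" where
  "graph_iso G H \<longleftrightarrow> (\<exists>f. bij_betw f (verts G) (verts H) \<and>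
     (\<forall>u\<in>verts G. \<forall>v\<in>verts G. {u, v} \<in> edges G \<longleftrightarrow> {f u, f v} \<in> edges H))"

definition induced_subgraph :: "'a ugraph \<Rightarrow> 'a set \<Rightarrow> 'a ugraph" where
  "induced_subgraph G S = (S, {e \<in> edges G. e \<subseteq> S})"

definition C4 :: "nat ugraph" where
  "C4 = ({0, 1, 2, 3}, {{0, 1}, {1, 2}, {2, 3}, {3, 0}})"

definition induced_free :: "'b ugraph \<Rightarrow> 'a ugraph set" where
  "induced_free F =
     {G. simple_graph G \<and> (\<forall>S \<subseteq> verts G. \<not> graph_iso (induced_subgraph G S) F)}"

text \<open>
  The distance is only meant for graphs on a common vertex set. On the empty vertex set the
  denominator vanishes and the distance is \<open>0\<close>.
\<close>

definition graph_dist :: "'a ugraph \<Rightarrow> 'a ugraph \<Rightarrow> real" where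
  "graph_dist G H =
     real (card (edges G - edges H) + card (edges H - edges G)) / real (card (verts G)) ^ 2"

definition property_dist :: "'a ugraph \<Rightarrow> 'a ugraph set \<Rightarrow> real" where
  "property_dist G P = Min {graph_dist G H |H. H \<in> P \<and> simple_graph H \<and> verts H = verts G}"

text \<open>
  The minimum ranges over a finite set, and for induced \<open>C\<^sub>4\<close>-freeness over a nonempty one, so
  that \<^const>\<open>Min\<close> is a genuine minimum.
\<close>

lemma finite_property_dist:
  assumes "simple_graph G"
  shows "finite {graph_dist G H |H. H \<in> P \<and> simple_graph H \<and> verts H = verts G}"
proof -
  have "{H. simple_graph H \<and> verts H = verts G} \<subseteq> {verts G} \<times> Pow (Pow (verts G))"
    unfolding simple_graph_def by fastforce
  moreover have "finite ({verts G} \<times> Pow (Pow (verts G)))"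
    using assms unfolding simple_graph_def by simp
  ultimately have "finite {H. simple_graph H \<and> verts H = verts G}"
    by (rule finite_subset)
  then have "finite (graph_dist G ` {H. simple_graph H \<and> verts H = verts G})"
    by simp
  then show ?thesis
    by (rule rev_finite_subset) auto
qed

lemma edgeless_induced_C4_free:
  assumes "finite V"
  shows "(V, {}) \<in> induced_free C4"
proof -
  have "\<not> graph_iso (induced_subgraph (V, {}) S) C4" for S :: "'a set"
  proof
    assume "graph_iso (induced_subgraph (V, {}) S) C4"
    then obtain f where f: "bij_betw f S {0, 1, 2, 3}"
      and e: "\<And>u v. u \<in> S \<Longrightarrow> v \<in> S \<Longrightarrow> {f u, f v} \<notin> edges C4"
      unfolding graph_iso_def induced_subgraph_def by (auto simp: C4_def)
    have "0 \<in> f ` S" "1 \<in> f ` S"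
      using f unfolding bij_betw_def by auto
    then show False
      using e unfolding C4_def by fastforce
  qed
  then show ?thesis
    using assms unfolding induced_free_def simple_graph_def by simp
qed

text \<open>
  A deterministic adaptive query algorithm is a decision tree. At \<open>Query u v yes no\<close> it asks for the
  \<open>(u, v)\<close> entry of the adjacency matrix and continues with \<open>yes\<close> or \<open>no\<close> according to the answer.
  Queries to the diagonal or outside the vertex set are answered negatively.
\<close>

datatype query_tree =
    Output real
  | Query nat nat query_tree query_tree

primrec run_tree :: "query_tree \<Rightarrow> nat ugraph \<Rightarrow> real" where
  "run_tree (Output x) G = x"
| "run_tree (Query u v yes no) G =
     (if {u, v} \<in> edges G then run_tree yes G else run_tree no G)"

primrec num_queries :: "query_tree \<Rightarrow> nat ugraph \<Rightarrow> nat" where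
  "num_queries (Output x) G = 0"
| "num_queries (Query u v yes no) G =
     Suc (if {u, v} \<in> edges G then num_queries yes G else num_queries no G)"

text \<open>
  A randomized algorithm is a distribution over deterministic ones. It is given the number \<open>n\<close> of
  rows of the adjacency matrix and the accuracy \<open>\<epsilon>\<close>. Rows are indexed by \<open>{..<n}\<close>.
\<close>

type_synonym randomized_algorithm = "nat \<Rightarrow> real \<Rightarrow> query_tree pmf"

definition distance_approximation_algorithm ::
    "randomized_algorithm \<Rightarrow> nat ugraph set \<Rightarrow> bool" where
  "distance_approximation_algorithm A P \<longleftrightarrow>
     (\<forall>n. \<forall>G. simple_graph G \<and> verts G = {..<n} \<longrightarrow>
       (\<forall>\<epsilon>. 0 < \<epsilon> \<and> \<epsilon> < 1 \<longrightarrow>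
         measure_pmf.prob (A n \<epsilon>) {t. \<bar>run_tree t G - property_dist G P\<bar> \<le> \<epsilon>} \<ge> 2 / 3))"

text \<open>
  The bound is on the worst case over all inputs and all random choices, uniformly in \<open>n\<close>.
\<close>

definition query_complexity_le :: "randomized_algorithm \<Rightarrow> (real \<Rightarrow> real) \<Rightarrow> bool" where
  "query_complexity_le A q \<longleftrightarrow>
     (\<forall>\<epsilon>. 0 < \<epsilon> \<and> \<epsilon> < 1 \<longrightarrow>
       (\<forall>n. \<forall>G. simple_graph G \<and> verts G = {..<n} \<longrightarrow>
         (\<forall>t \<in> set_pmf (A n \<epsilon>). real (num_queries t G) \<le> q \<epsilon>)))"

end

theory Submission
  imports Defs
begin

text \<open>
  In an induced \<open>C\<^sub>4\<close>-free graph, remove large disjoint cliques greedily, leaving a set \<open>Y\<close> without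
  large cliques. The complement of an induced \<open>C\<^sub>4\<close>-free graph has no induced \<open>2K\<^sub>2\<close>, so a vertex
  set spanning few nonadjacent pairs becomes a clique after the deletion of few vertices. The common
  neighbours in \<open>Y\<close> of two nonadjacent vertices form a clique, hence there are few of them, and so the
  neighbourhood of an average vertex of \<open>Y\<close> is almost a clique. In particular \<open>Y\<close> is almost
  independent. Between two of the removed cliques the neighbourhoods form a chain. Grouping their
  vertices by approximate degrees into all of these cliques gives exponentially many classes, and one
  random representative per class yields a pattern, itself induced \<open>C\<^sub>4\<close>-free, whose blow-up by cliques
  approximates the graph. After a further deletion every vertex of \<open>Y\<close> sees only a clique of the
  pattern. Conversely, every graph of this form is induced \<open>C\<^sub>4\<close>-free. So the distance to induced
  \<open>C\<^sub>4\<close>-freeness is, up to a small error, half the least cost of a labelling of the vertices for a cost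
  that is a sum over pairs.

  The number of labels enters the estimate of this minimum only through its logarithm. Start from a
  mixture of \<open>l\<close> copies of an optimal labelling and replace the copies one by one by greedy labellings
  computed from small samples labelled by the optimum. Each replacement increases the cost of the
  mixture only slightly, and a mixture costs at least as much as some labelling. The algorithm tries
  all labellings of the samples and estimates the cost of each resulting mixture on random pairs.
\<close>

section \<open>Random choices\<close>

lemma pmf_exists_le_expectation:
  fixes X :: "'a \<Rightarrow> real"
  assumes fin: "finite (set_pmf p)"
  shows "\<exists>x\<in>set_pmf p. X x \<le> measure_pmf.expectation p X"
proof (rule ccontr)
  let ?e = "measure_pmf.expectation p X"
  assume "\<not> ?thesis"
  then have gt: "X x > ?e" if "x \<in> set_pmf p" for x
    using that by auto
  have e: "?e = (\<Sum>x\<in>set_pmf p. X x * pmf p x)"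
    using fin by (subst integral_measure_pmf_real[where A = "set_pmf p"]) auto
  have "(\<Sum>x\<in>set_pmf p. ?e * pmf p x) < (\<Sum>x\<in>set_pmf p. X x * pmf p x)"
    using fin gt set_pmf_not_empty[of p]
    by (intro sum_strict_mono mult_strict_right_mono) (auto simp: pmf_positive)
  moreover have "(\<Sum>x\<in>set_pmf p. pmf p x) = 1"
    using fin by (rule sum_pmf_eq_1) simp
  ultimately show False
    using e by (simp flip: sum_distrib_left)
qed

lemma map_pmf_pair_Pi_pmf:
  assumes "finite I" "i \<in> I" "j \<in> I" "i \<noteq> j"
  shows "map_pmf (\<lambda>f. (f i, f j)) (Pi_pmf I d p) = pair_pmf (p i) (p j)"
proof -
  have I: "I = insert i (I - {i})" using assms by auto
  have "map_pmf (\<lambda>f. (f i, f j)) (Pi_pmf I d p) =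
      map_pmf (\<lambda>(y, f). (y, f j)) (pair_pmf (p i) (Pi_pmf (I - {i}) d p))"
    using assms
    by (subst I, subst Pi_pmf_insert) (auto simp: pmf.map_comp o_def intro!: map_pmf_cong)
  also have "\<dots> = pair_pmf (p i) (map_pmf (\<lambda>f. f j) (Pi_pmf (I - {i}) d p))"
    by (simp add: pair_map_pmf2 map_prod_def apsnd_def id_def)
  also have "\<dots> = pair_pmf (p i) (p j)"
    using assms by (simp add: Pi_pmf_component)
  finally show ?thesis .
qed

text \<open>First-moment method: drawing each \<open>\<rho> i\<close> uniformly and independently
  from \<open>C i\<close> turns the right-hand side into the expected value of the left-hand side.
  The diagonal is left out because \<open>\<rho> i\<close> is not independent of itself. This serves
  both to round a mixture of labellings and to choose class representatives.\<close>

lemma independent_choice_le: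
  fixes \<kappa> :: "'i \<Rightarrow> 'i \<Rightarrow> 'a \<Rightarrow> 'a \<Rightarrow> real"
  assumes I: "finite I" and C: "\<And>i. i \<in> I \<Longrightarrow> finite (C i)" "\<And>i. i \<in> I \<Longrightarrow> C i \<noteq> {}"
  obtains \<rho> where "\<And>i. i \<in> I \<Longrightarrow> \<rho> i \<in> C i"
    and "(\<Sum>i\<in>I. \<Sum>j\<in>I - {i}. \<kappa> i j (\<rho> i) (\<rho> j)) \<le>
      (\<Sum>i\<in>I. \<Sum>j\<in>I - {i}. (\<Sum>x\<in>C i. \<Sum>y\<in>C j. \<kappa> i j x y) / (real (card (C i)) * real (card (C j))))"
proof -
  define P where "P = Pi_pmf I undefined (\<lambda>i. pmf_of_set (C i))"
  have fin: "finite (set_pmf P)"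
  proof -
    have "set_pmf P \<subseteq> PiE_dflt I undefined C"
      unfolding P_def set_Pi_pmf[OF I] using C by (force simp: PiE_dflt_def)
    moreover have "finite (PiE_dflt I undefined C)"
      using I C by (intro finite_PiE_dflt) auto
    ultimately show ?thesis by (rule finite_subset)
  qed
  have int: "integrable (measure_pmf P) f" for f :: "_ \<Rightarrow> real"
    using fin by (rule integrable_measure_pmf_finite)
  have E: "measure_pmf.expectation P (\<lambda>\<rho>. \<kappa> i j (\<rho> i) (\<rho> j)) =
      (\<Sum>x\<in>C i. \<Sum>y\<in>C j. \<kappa> i j x y) / (real (card (C i)) * real (card (C j)))"
    if ij: "i \<in> I" "j \<in> I - {i}" for i j
  proof -
    have "map_pmf (\<lambda>\<rho>. (\<rho> i, \<rho> j)) P = pair_pmf (pmf_of_set (C i)) (pmf_of_set (C j))"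
      unfolding P_def using ij I by (subst map_pmf_pair_Pi_pmf) auto
    also have "\<dots> = pmf_of_set (C i \<times> C j)"
    proof (rule pmf_eqI)
      fix x :: "'a \<times> 'a"
      obtain a b where "x = (a, b)" by force
      then show "pmf (pair_pmf (pmf_of_set (C i)) (pmf_of_set (C j))) x = pmf (pmf_of_set (C i \<times> C j)) x"
        using ij C[of i] C[of j] by (simp add: pmf_pair indicator_def card_cartesian_product)
    qed
    finally have m: "map_pmf (\<lambda>\<rho>. (\<rho> i, \<rho> j)) P = pmf_of_set (C i \<times> C j)" .
    have "measure_pmf.expectation P (\<lambda>\<rho>. \<kappa> i j (\<rho> i) (\<rho> j)) =
        measure_pmf.expectation (map_pmf (\<lambda>\<rho>. (\<rho> i, \<rho> j)) P) (\<lambda>(x, y). \<kappa> i j x y)"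
      by simp
    also have "\<dots> = (\<Sum>(x, y)\<in>C i \<times> C j. \<kappa> i j x y) / real (card (C i \<times> C j))"
      unfolding m using ij C[of i] C[of j] by (intro integral_pmf_of_set) auto
    finally show ?thesis
      by (simp add: sum.cartesian_product card_cartesian_product)
  qed
  obtain \<rho> where "\<rho> \<in> set_pmf P"
    and le: "(\<Sum>i\<in>I. \<Sum>j\<in>I - {i}. \<kappa> i j (\<rho> i) (\<rho> j)) \<le>
      measure_pmf.expectation P (\<lambda>\<rho>. \<Sum>i\<in>I. \<Sum>j\<in>I - {i}. \<kappa> i j (\<rho> i) (\<rho> j))"
    using pmf_exists_le_expectation[OF fin, of "\<lambda>\<rho>. \<Sum>i\<in>I. \<Sum>j\<in>I - {i}. \<kappa> i j (\<rho> i) (\<rho> j)"]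
    by auto
  moreover have "measure_pmf.expectation P (\<lambda>\<rho>. \<Sum>i\<in>I. \<Sum>j\<in>I - {i}. \<kappa> i j (\<rho> i) (\<rho> j)) =
      (\<Sum>i\<in>I. \<Sum>j\<in>I - {i}. (\<Sum>x\<in>C i. \<Sum>y\<in>C j. \<kappa> i j x y) / (real (card (C i)) * real (card (C j))))"
    unfolding Bochner_Integration.integral_sum[OF int] by (intro sum.cong refl E)
  moreover have "\<rho> i \<in> C i" if "i \<in> I" for i
  proof -
    have "\<rho> \<in> PiE_dflt I undefined (\<lambda>i. C i)"
      using \<open>\<rho> \<in> set_pmf P\<close> C unfolding P_def set_Pi_pmf[OF I]
      by (force simp: PiE_dflt_def)
    then show ?thesis using that by (auto simp: PiE_dflt_def)
  qed
  ultimately show ?thesis by (intro that) auto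
qed

lemma Hoeffding_Pi_pmf:
  fixes h :: "'a \<Rightarrow> real"
  assumes h: "\<And>x. x \<in> set_pmf p \<Longrightarrow> 0 \<le> h x \<and> h x \<le> 1" and t: "t > 0" and \<theta>: "\<theta> \<ge> 0"
  shows "measure_pmf.prob (Pi_pmf {..<t} d (\<lambda>_. p))
      {w. \<bar>(\<Sum>s<t. h (w s)) / real t - measure_pmf.expectation p h\<bar> > \<theta>} \<le> 2 * exp (- 2 * real t * \<theta>\<^sup>2)"
proof -
  define P where "P = Pi_pmf {..<t} d (\<lambda>_. p)"
  have mp: "map_pmf (\<lambda>w. w i) P = p" if "i < t" for i
    using that by (simp add: P_def Pi_pmf_component)
  have AEp: "AE x in measure_pmf p. h x \<in> {0..1}"
    using h by (auto simp: AE_measure_pmf_iff)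
  have iv: "indep_interval_bounded_random_variables (measure_pmf P) {..<t} (\<lambda>i w. h (w i)) (\<lambda>_. 0) (\<lambda>_. 1)"
  proof unfold_locales
    show "prob_space.indep_vars (measure_pmf P) (\<lambda>_. borel) (\<lambda>i w. h (w i)) {..<t}"
      unfolding P_def
      by (intro prob_space.indep_vars_compose2[OF _ indep_vars_Pi_pmf])
         (auto simp: measure_pmf.prob_space_axioms)
    fix i assume "i \<in> {..<t}"
    then have i: "i < t" by simp
    have "AE x in measure_pmf (map_pmf (\<lambda>w. w i) P). h x \<in> {0..1}"
      unfolding mp[OF i] by (fact AEp)
    then show "AE w in measure_pmf P. h (w i) \<in> {0..1}"
      by (simp add: AE_measure_pmf_iff)
  qed auto
  have E: "measure_pmf.expectation P (\<lambda>w. h (w i)) = measure_pmf.expectation p h" if "i < t" for i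
  proof -
    have "measure_pmf.expectation P (\<lambda>w. h (w i)) = measure_pmf.expectation (map_pmf (\<lambda>w. w i) P) h"
      by simp
    then show ?thesis by (simp add: mp[OF that])
  qed
  interpret I: indep_interval_bounded_random_variables "measure_pmf P" "{..<t}" "\<lambda>i w. h (w i)" "\<lambda>_. 0" "\<lambda>_. 1"
    by (fact iv)
  interpret H: Hoeffding_ineq "measure_pmf P" "{..<t}" "\<lambda>i w. h (w i)" "\<lambda>_. 0" "\<lambda>_. 1"
      "\<Sum>i\<in>{..<t}. measure_pmf.expectation P (\<lambda>w. h (w i))"
    by unfold_locales
  have "measure_pmf.prob P {w. \<bar>(\<Sum>s<t. h (w s)) / real t - measure_pmf.expectation p h\<bar> > \<theta>} \<le>
      measure_pmf.prob P {w \<in> space (measure_pmf P). \<bar>(\<Sum>i<t. h (w i)) -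
        (\<Sum>i\<in>{..<t}. measure_pmf.expectation P (\<lambda>w. h (w i)))\<bar> \<ge> real t * \<theta>}"
  proof (rule measure_pmf.finite_measure_mono)
    show "{w. \<bar>(\<Sum>s<t. h (w s)) / real t - measure_pmf.expectation p h\<bar> > \<theta>} \<subseteq>
      {w \<in> space (measure_pmf P). \<bar>(\<Sum>i<t. h (w i)) -
        (\<Sum>i\<in>{..<t}. measure_pmf.expectation P (\<lambda>w. h (w i)))\<bar> \<ge> real t * \<theta>}"
    proof safe
      fix w assume *: "\<bar>(\<Sum>s<t. h (w s)) / real t - measure_pmf.expectation p h\<bar> > \<theta>"
      have "\<bar>(\<Sum>i<t. h (w i)) - (\<Sum>i\<in>{..<t}. measure_pmf.expectation P (\<lambda>w. h (w i)))\<bar>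
         = \<bar>real t * ((\<Sum>s<t. h (w s)) / real t - measure_pmf.expectation p h)\<bar>"
        using t by (simp add: E right_diff_distrib)
      also have "\<dots> = real t * \<bar>(\<Sum>s<t. h (w s)) / real t - measure_pmf.expectation p h\<bar>"
        by (simp add: abs_mult)
      also have "\<dots> \<ge> real t * \<theta>"
        using * by (intro mult_left_mono) auto
      finally show "\<bar>(\<Sum>i<t. h (w i)) - (\<Sum>i\<in>{..<t}. measure_pmf.expectation P (\<lambda>w. h (w i)))\<bar> \<ge> real t * \<theta>" .
    qed auto
  qed auto
  also have "\<dots> \<le> 2 * exp (- 2 * (real t * \<theta>)\<^sup>2 / (\<Sum>i\<in>{..<t}. (1 - 0)\<^sup>2))"
    using t \<theta> by (intro H.Hoeffding_ineq_abs_ge) auto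
  also have "\<dots> = 2 * exp (- 2 * real t * \<theta>\<^sup>2)"
    using t by (simp add: power_mult_distrib power2_eq_square)
  finally show ?thesis unfolding P_def .
qed

text \<open>Conditioning on the first component. It allows the bad event for the random pairs to
  depend on the vertex samples.\<close>

lemma prob_pair_pmf_le:
  assumes "\<And>x. x \<in> set_pmf p \<Longrightarrow> measure_pmf.prob q {y. Q x y} \<le> c"
  shows "measure_pmf.prob (pair_pmf p q) {(x, y). Q x y} \<le> c"
proof -
  obtain x0 where "x0 \<in> set_pmf p"
    using set_pmf_not_empty[of p] by auto
  then have "c \<ge> 0"
    using assms[of x0] measure_nonneg[of "measure_pmf q" "{y. Q x0 y}"] by linarith
  have "pair_pmf p q = bind_pmf p (\<lambda>x. map_pmf (Pair x) q)"
    by (simp add: pair_pmf_def map_pmf_def)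
  then have "emeasure (measure_pmf (pair_pmf p q)) {(x, y). Q x y} =
      (\<integral>\<^sup>+x. emeasure (measure_pmf (map_pmf (Pair x) q)) {(x, y). Q x y} \<partial>measure_pmf p)"
    by (simp only: emeasure_bind_pmf)
  also have "\<dots> = (\<integral>\<^sup>+x. emeasure (measure_pmf q) {y. Q x y} \<partial>measure_pmf p)"
    by (intro nn_integral_cong) (simp add: vimage_def)
  also have "\<dots> \<le> (\<integral>\<^sup>+x. ennreal c \<partial>measure_pmf p)"
    using assms \<open>c \<ge> 0\<close>
    by (intro nn_integral_mono_AE) (auto simp: AE_measure_pmf_iff measure_pmf.emeasure_eq_measure)
  also have "\<dots> = ennreal c" by simp
  finally show ?thesis
    using \<open>c \<ge> 0\<close> by (simp add: measure_pmf.emeasure_eq_measure)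
qed

section \<open>Sampling the minimum of a pairwise labelling cost\<close>

text \<open>Round \<open>i\<close> gives every vertex the label that looks cheapest on the sample
  \<open>U i\<close> against the current mixture, which consists of the \<open>i\<close> greedy
  labellings found so far and \<open>l - i\<close> copies of a reference labelling. The reference
  labelling matters only at the sample points, and \<open>\<Lambda> i s\<close> is the guess for its
  value at \<open>U i s\<close>.\<close>

primrec greedy_labellings ::
    "'l set \<Rightarrow> (nat \<Rightarrow> nat \<Rightarrow> 'l \<Rightarrow> 'l \<Rightarrow> real) \<Rightarrow> nat \<Rightarrow> nat \<Rightarrow> (nat \<Rightarrow> nat \<Rightarrow> nat) \<Rightarrow>
      (nat \<Rightarrow> nat \<Rightarrow> 'l) \<Rightarrow> nat \<Rightarrow> nat \<Rightarrow> nat \<Rightarrow> 'l" where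
  "greedy_labellings L \<kappa> l t U \<Lambda> 0 = (\<lambda>_ _. undefined)"
| "greedy_labellings L \<kappa> l t U \<Lambda> (Suc i) = (greedy_labellings L \<kappa> l t U \<Lambda> i)(i := \<lambda>v.
     arg_min_on (\<lambda>j. \<Sum>s<t. \<Sum>i'<l. \<kappa> v (U i s) j
       (if i' < i then greedy_labellings L \<kappa> l t U \<Lambda> i i' (U i s) else \<Lambda> i s)) L)"

definition pair_cost :: "nat \<Rightarrow> (nat \<Rightarrow> nat \<Rightarrow> 'l \<Rightarrow> 'l \<Rightarrow> real) \<Rightarrow> (nat \<Rightarrow> 'l) \<Rightarrow> (nat \<Rightarrow> 'l) \<Rightarrow> real" where
  "pair_cost n \<kappa> f g = (\<Sum>u<n. \<Sum>v<n. \<kappa> u v (f u) (g v)) / real n ^ 2"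

text \<open>For a cost that vanishes on the diagonal this is the expected \<open>pair_cost\<close>
  when each vertex independently picks one of the \<open>l\<close> labellings.\<close>

definition mixture_cost :: "nat \<Rightarrow> (nat \<Rightarrow> nat \<Rightarrow> 'l \<Rightarrow> 'l \<Rightarrow> real) \<Rightarrow> nat \<Rightarrow> (nat \<Rightarrow> nat \<Rightarrow> 'l) \<Rightarrow> real" where
  "mixture_cost n \<kappa> l H = (\<Sum>i<l. \<Sum>j<l. pair_cost n \<kappa> (H i) (H j)) / real l ^ 2"

definition sampled_cost ::
    "(nat \<Rightarrow> nat \<Rightarrow> 'l \<Rightarrow> 'l \<Rightarrow> real) \<Rightarrow> nat \<Rightarrow> nat \<Rightarrow> (nat \<Rightarrow> nat \<Rightarrow> 'l) \<Rightarrow> (nat \<Rightarrow> nat \<times> nat) \<Rightarrow> real" where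
  "sampled_cost \<kappa> l m H W =
     (\<Sum>k<m. (\<Sum>i<l. \<Sum>j<l. \<kappa> (fst (W k)) (snd (W k)) (H i (fst (W k))) (H j (snd (W k)))) / real l ^ 2) / real m"

text \<open>The optimal labels of the samples are unknown, so all guesses are tried. A wrong guess
  does no harm, since no mixture is cheaper than the best labelling.\<close>

definition estimate ::
    "'l set \<Rightarrow> (nat \<Rightarrow> nat \<Rightarrow> 'l \<Rightarrow> 'l \<Rightarrow> real) \<Rightarrow> nat \<Rightarrow> nat \<Rightarrow> nat \<Rightarrow>
      (nat \<Rightarrow> nat \<Rightarrow> nat) \<Rightarrow> (nat \<Rightarrow> nat \<times> nat) \<Rightarrow> real" where
  "estimate L \<kappa> l t m U W =
     Min ((\<lambda>\<Lambda>. sampled_cost \<kappa> l m (greedy_labellings L \<kappa> l t U \<Lambda> l) W) `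
       ({..<l} \<rightarrow>\<^sub>E {..<t} \<rightarrow>\<^sub>E L))"

text \<open>The labellings of the first \<open>i\<close> rounds depend only on the data of these
  rounds and on costs between the labelled vertex and sample points or among sample points. This
  locality shows that queries among sample points suffice, that a fresh sample leaves earlier rounds
  alone, and that a guess may be replaced by its restriction.\<close>

lemma greedy_labellings_cong:
  assumes "\<And>i' s. i' < i \<Longrightarrow> s < t \<Longrightarrow> U i' s = U' i' s \<and> \<Lambda> i' s = \<Lambda>' i' s \<and> U i' s \<in> S"
    and "\<And>u v. u \<in> S \<Longrightarrow> v \<in> S \<Longrightarrow> \<kappa> u v = \<kappa>' u v" and "v \<in> S"
  shows "greedy_labellings L \<kappa> l t U \<Lambda> i i' v = greedy_labellings L \<kappa>' l t U' \<Lambda>' i i' v"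
  using assms(1,3)
proof (induction i arbitrary: i' v)
  case (Suc i)
  have IH: "greedy_labellings L \<kappa> l t U \<Lambda> i i' v = greedy_labellings L \<kappa>' l t U' \<Lambda>' i i' v"
    if "v \<in> S" for i' v
    by (rule Suc.IH) (use that Suc.prems(1)[OF less_SucI] in blast)+
  have "(\<Sum>s<t. \<Sum>i'<l. \<kappa> v (U i s) j (if i' < i then greedy_labellings L \<kappa> l t U \<Lambda> i i' (U i s) else \<Lambda> i s)) =
      (\<Sum>s<t. \<Sum>i'<l. \<kappa>' v (U' i s) j (if i' < i then greedy_labellings L \<kappa>' l t U' \<Lambda>' i i' (U' i s) else \<Lambda>' i s))" for j
  proof (intro sum.cong refl)
    fix s i' assume "s \<in> {..<t}"
    then have "U i s = U' i s \<and> \<Lambda> i s = \<Lambda>' i s \<and> U i s \<in> S"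
      using Suc.prems(1)[OF lessI, of s] unfolding lessThan_iff by blast
    then show "\<kappa> v (U i s) j (if i' < i then greedy_labellings L \<kappa> l t U \<Lambda> i i' (U i s) else \<Lambda> i s) =
      \<kappa>' v (U' i s) j (if i' < i then greedy_labellings L \<kappa>' l t U' \<Lambda>' i i' (U' i s) else \<Lambda>' i s)"
      using IH[of "U i s" i'] assms(2)[of v "U i s"] Suc.prems(2) by auto
  qed
  then show ?case
    using IH[OF Suc.prems(2)] by simp
qed simp

lemma greedy_labellings_in:
  assumes "finite L" "L \<noteq> {}" "i' < i"
  shows "greedy_labellings L \<kappa> l t U \<Lambda> i i' v \<in> L"
  using assms(3) by (induction i) (auto intro!: arg_min_if_finite(1) assms)

lemma sum_swap_pairs:
  "(\<Sum>i\<in>A. \<Sum>j\<in>B. \<Sum>u\<in>C. \<Sum>v\<in>D. f i j u v) = (\<Sum>u\<in>C. \<Sum>v\<in>D. \<Sum>i\<in>A. \<Sum>j\<in>B. f i j u v)"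
proof -
  have "(\<Sum>i\<in>A. \<Sum>j\<in>B. \<Sum>u\<in>C. \<Sum>v\<in>D. f i j u v) = (\<Sum>i\<in>A. \<Sum>u\<in>C. \<Sum>j\<in>B. \<Sum>v\<in>D. f i j u v)"
    by (intro sum.cong refl sum.swap)
  also have "\<dots> = (\<Sum>u\<in>C. \<Sum>i\<in>A. \<Sum>j\<in>B. \<Sum>v\<in>D. f i j u v)"
    by (rule sum.swap)
  also have "\<dots> = (\<Sum>u\<in>C. \<Sum>i\<in>A. \<Sum>v\<in>D. \<Sum>j\<in>B. f i j u v)"
    by (intro sum.cong refl sum.swap)
  also have "\<dots> = (\<Sum>u\<in>C. \<Sum>v\<in>D. \<Sum>i\<in>A. \<Sum>j\<in>B. f i j u v)"
    by (intro sum.cong refl sum.swap)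
  finally show ?thesis .
qed

lemma estimate_cong:
  assumes U: "\<And>i s. i < l \<Longrightarrow> s < t \<Longrightarrow> U i s \<in> S"
    and W: "\<And>k. k < m \<Longrightarrow> fst (W k) \<in> S \<and> snd (W k) \<in> S"
    and \<kappa>: "\<And>u v. u \<in> S \<Longrightarrow> v \<in> S \<Longrightarrow> \<kappa> u v = \<kappa>' u v"
  shows "estimate L \<kappa> l t m U W = estimate L \<kappa>' l t m U W"
proof -
  have g: "greedy_labellings L \<kappa> l t U \<Lambda> l i v = greedy_labellings L \<kappa>' l t U \<Lambda> l i v"
    if "v \<in> S" for i v \<Lambda>
    by (rule greedy_labellings_cong[where S = S]) (use U \<kappa> that in auto)
  have "sampled_cost \<kappa> l m (greedy_labellings L \<kappa> l t U \<Lambda> l) W =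
      sampled_cost \<kappa>' l m (greedy_labellings L \<kappa>' l t U \<Lambda> l) W" for \<Lambda>
    unfolding sampled_cost_def
    by (intro sum.cong arg_cong2[where f = "(/)"] refl) (use g W \<kappa> in auto)
  then show ?thesis
    unfolding estimate_def by simp
qed

section \<open>Costs of mixtures of labellings\<close>

locale pair_labelling =
  fixes n :: nat and L :: "'l set" and \<kappa> :: "nat \<Rightarrow> nat \<Rightarrow> 'l \<Rightarrow> 'l \<Rightarrow> real"
  assumes n: "n > 0" and L: "finite L" "L \<noteq> {}"
    and cost_bounds: "\<And>u v a b. a \<in> L \<Longrightarrow> b \<in> L \<Longrightarrow> 0 \<le> \<kappa> u v a b \<and> \<kappa> u v a b \<le> 1"
    and cost_sym: "\<And>u v a b. a \<in> L \<Longrightarrow> b \<in> L \<Longrightarrow> \<kappa> u v a b = \<kappa> v u b a"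
    and cost_diag: "\<And>u a b. \<kappa> u u a b = 0"
begin

lemma pair_cost_sym:
  assumes "\<And>v. f v \<in> L" "\<And>v. g v \<in> L"
  shows "pair_cost n \<kappa> f g = pair_cost n \<kappa> g f"
  unfolding pair_cost_def
  by (subst sum.swap) (use assms cost_sym in \<open>auto intro!: arg_cong2[where f = "(/)"] sum.cong\<close>)

lemma pair_cost_bounds:
  assumes "\<And>v. f v \<in> L" "\<And>v. g v \<in> L"
  shows "0 \<le> pair_cost n \<kappa> f g" "pair_cost n \<kappa> f g \<le> 1"
proof -
  show "0 \<le> pair_cost n \<kappa> f g"
    unfolding pair_cost_def using assms cost_bounds by (intro divide_nonneg_nonneg sum_nonneg) auto
  have "(\<Sum>u<n. \<Sum>v<n. \<kappa> u v (f u) (g v)) \<le> (\<Sum>u<n. \<Sum>v<n. 1)"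
    using assms cost_bounds by (intro sum_mono) auto
  then show "pair_cost n \<kappa> f g \<le> 1"
    unfolding pair_cost_def using n by (simp add: power2_eq_square field_simps)
qed

text \<open>Let every vertex independently pick one of the \<open>l\<close> labellings. Off the
  diagonal the expected cost of a pair is its cost in the mixture, and the diagonal contributes
  nothing on either side.\<close>

lemma mixture_cost_rounding:
  assumes H: "\<And>i v. i < l \<Longrightarrow> H i v \<in> L" and l: "l > 0"
  shows "\<exists>f. (\<forall>v. f v \<in> L) \<and> pair_cost n \<kappa> f f \<le> mixture_cost n \<kappa> l H"
proof -
  obtain a where a: "a \<in> L" using L by auto
  obtain \<rho> where \<rho>: "\<And>u. u \<in> {..<n} \<Longrightarrow> \<rho> u \<in> {..<l}"
    and le: "(\<Sum>u\<in>{..<n}. \<Sum>v\<in>{..<n} - {u}. \<kappa> u v (H (\<rho> u) u) (H (\<rho> v) v)) \<le>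
      (\<Sum>u\<in>{..<n}. \<Sum>v\<in>{..<n} - {u}. (\<Sum>i\<in>{..<l}. \<Sum>j\<in>{..<l}. \<kappa> u v (H i u) (H j v)) /
        (real (card {..<l}) * real (card {..<l})))"
    by (rule independent_choice_le[where I = "{..<n}" and C = "\<lambda>_. {..<l}" and
        \<kappa> = "\<lambda>u v i j. \<kappa> u v (H i u) (H j v)"]) (use l in auto)
  have diag: "(\<Sum>v\<in>{..<n} - {u}. h v) = (\<Sum>v<n. h v)" if "h u = 0" for u and h :: "nat \<Rightarrow> real"
    using that by (intro sum.mono_neutral_left) auto
  have le': "(\<Sum>u<n. \<Sum>v<n. \<kappa> u v (H (\<rho> u) u) (H (\<rho> v) v)) \<le>
      (\<Sum>u<n. \<Sum>v<n. (\<Sum>i<l. \<Sum>j<l. \<kappa> u v (H i u) (H j v)) / real l ^ 2)"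
    using le by (simp add: diag cost_diag power2_eq_square)
  \<comment> \<open>The default \<open>a\<close> serves the vertices beyond \<open>n\<close>, where
    \<open>\<rho>\<close> need not be an index below \<open>l\<close>.\<close>
  define f where "f u = (if u < n then H (\<rho> u) u else a)" for u
  have "f v \<in> L" for v
    using a H \<rho> by (auto simp: f_def)
  moreover have "pair_cost n \<kappa> f f \<le> mixture_cost n \<kappa> l H"
  proof -
    have "(\<Sum>i<l. \<Sum>j<l. \<Sum>u<n. \<Sum>v<n. \<kappa> u v (H i u) (H j v)) =
        (\<Sum>u<n. \<Sum>v<n. \<Sum>i<l. \<Sum>j<l. \<kappa> u v (H i u) (H j v))"
      by (rule sum_swap_pairs)
    then have m: "mixture_cost n \<kappa> l H =
        (\<Sum>u<n. \<Sum>v<n. (\<Sum>i<l. \<Sum>j<l. \<kappa> u v (H i u) (H j v)) / real l ^ 2) / real n ^ 2"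
      by (simp add: mixture_cost_def pair_cost_def flip: sum_divide_distrib)
    have "pair_cost n \<kappa> f f = (\<Sum>u<n. \<Sum>v<n. \<kappa> u v (H (\<rho> u) u) (H (\<rho> v) v)) / real n ^ 2"
      by (simp add: pair_cost_def f_def)
    then show ?thesis
      unfolding m using le' by (simp add: divide_right_mono)
  qed
  ultimately show ?thesis by blast
qed

text \<open>The price of label \<open>a\<close> at \<open>v\<close> against the mixture, averaged
  over the other vertex. The greedy rounds minimise a sampled version of it.\<close>

definition label_cost :: "nat \<Rightarrow> (nat \<Rightarrow> nat \<Rightarrow> 'l) \<Rightarrow> nat \<Rightarrow> 'l \<Rightarrow> real" where
  "label_cost l H v a = (\<Sum>u<n. (\<Sum>j<l. \<kappa> v u a (H j u)) / real l) / real n"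

lemma sum_pair_cost:
  "(\<Sum>j<l. pair_cost n \<kappa> f (H j)) = real l / real n * (\<Sum>v<n. label_cost l H v (f v))"
proof (cases "l = 0")
  case False
  have "(\<Sum>j<l. \<Sum>v<n. \<Sum>u<n. \<kappa> v u (f v) (H j u)) = (\<Sum>v<n. \<Sum>j<l. \<Sum>u<n. \<kappa> v u (f v) (H j u))"
    by (rule sum.swap)
  also have "\<dots> = (\<Sum>v<n. \<Sum>u<n. \<Sum>j<l. \<kappa> v u (f v) (H j u))"
    by (intro sum.cong refl sum.swap)
  finally show ?thesis
    using False by (simp add: pair_cost_def label_cost_def power2_eq_square field_simps flip: sum_divide_distrib)
qed simp

text \<open>The mixture cost is quadratic in its \<open>i\<close>-th component. By symmetry the
  linear change is twice the change in label costs, and the remainder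
  \<open>b g g + b (H i) (H i) - 2 * b g (H i)\<close> is at most 2 before the division by
  \<open>l ^ 2\<close>.\<close>

lemma mixture_cost_update:
  assumes H: "\<And>j v. j < l \<Longrightarrow> H j v \<in> L" and g: "\<And>v. g v \<in> L" and i: "i < l"
  shows "mixture_cost n \<kappa> l (H(i := g)) \<le> mixture_cost n \<kappa> l H +
    2 / (real l * real n) * (\<Sum>v<n. label_cost l H v (g v) - label_cost l H v (H i v)) + 2 / real l ^ 2"
proof -
  define b where "b = pair_cost n \<kappa>"
  define J where "J = {..<l} - {i}"
  have J: "{..<l} = insert i J" "finite J" "i \<notin> J" using i by (auto simp: J_def)
  have l: "l > 0" using i by simp
  have HL: "\<And>v. H j v \<in> L" if "j \<in> insert i J" for j using that J(1) H by auto
  have sym: "b (H j) f = b f (H j)" if "j \<in> insert i J" "\<And>v. f v \<in> L" for j f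
    unfolding b_def using HL that by (intro pair_cost_sym) auto
  define S where "S = (\<Sum>j\<in>J. \<Sum>j'\<in>J. b (H j) (H j'))"
  have H1: "(\<Sum>j<l. \<Sum>j'<l. b (H j) (H j')) = S + 2 * (\<Sum>j\<in>J. b (H i) (H j)) + b (H i) (H i)"
  proof -
    have "(\<Sum>j\<in>J. b (H j) (H i)) = (\<Sum>j\<in>J. b (H i) (H j))"
      using HL by (intro sum.cong refl sym) auto
    then show ?thesis
      unfolding J(1) S_def using J(2,3) by (simp add: sum.distrib)
  qed
  have "(\<Sum>j<l. \<Sum>j'<l. b ((H(i:=g)) j) ((H(i:=g)) j')) =
      (\<Sum>j\<in>J. \<Sum>j'\<in>J. b ((H(i:=g)) j) ((H(i:=g)) j')) + (\<Sum>j\<in>J. b ((H(i:=g)) j) g) +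
      (\<Sum>j\<in>J. b g ((H(i:=g)) j)) + b g g"
    unfolding J(1) using J(2,3) by (simp add: sum.distrib)
  also have "(\<Sum>j\<in>J. \<Sum>j'\<in>J. b ((H(i:=g)) j) ((H(i:=g)) j')) = S"
    unfolding S_def using J(3) by (intro sum.cong refl) auto
  also have "(\<Sum>j\<in>J. b ((H(i:=g)) j) g) = (\<Sum>j\<in>J. b g (H j))"
  proof (intro sum.cong refl)
    fix j assume "j \<in> J"
    then show "b ((H(i:=g)) j) g = b g (H j)"
      using J(3) g sym[of j g] by auto
  qed
  also have "(\<Sum>j\<in>J. b g ((H(i:=g)) j)) = (\<Sum>j\<in>J. b g (H j))"
    using J(3) by (intro sum.cong refl) auto
  finally have H2: "(\<Sum>j<l. \<Sum>j'<l. b ((H(i:=g)) j) ((H(i:=g)) j')) =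
      S + 2 * (\<Sum>j\<in>J. b g (H j)) + b g g" by simp
  have s: "(\<Sum>j<l. b f (H j)) = b f (H i) + (\<Sum>j\<in>J. b f (H j))" for f
    unfolding J(1) using J(2,3) by simp
  have "(\<Sum>j<l. \<Sum>j'<l. b ((H(i:=g)) j) ((H(i:=g)) j')) - (\<Sum>j<l. \<Sum>j'<l. b (H j) (H j')) =
      2 * ((\<Sum>j<l. b g (H j)) - (\<Sum>j<l. b (H i) (H j))) + (b g g + b (H i) (H i) - 2 * b g (H i))"
    unfolding H1 H2 using s[of g] s[of "H i"] by simp
  also have "\<dots> \<le> 2 * ((\<Sum>j<l. b g (H j)) - (\<Sum>j<l. b (H i) (H j))) + 2"
    using pair_cost_bounds[of g g] pair_cost_bounds[of "H i" "H i"] pair_cost_bounds[of g "H i"] g HL[of i]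
    by (simp add: b_def)
  also have "(\<Sum>j<l. b g (H j)) - (\<Sum>j<l. b (H i) (H j)) =
      real l / real n * (\<Sum>v<n. label_cost l H v (g v) - label_cost l H v (H i v))"
    unfolding b_def sum_pair_cost by (simp add: sum_subtractf right_diff_distrib)
  finally have "(\<Sum>j<l. \<Sum>j'<l. b ((H(i:=g)) j) ((H(i:=g)) j')) \<le> (\<Sum>j<l. \<Sum>j'<l. b (H j) (H j')) +
      2 * (real l / real n * (\<Sum>v<n. label_cost l H v (g v) - label_cost l H v (H i v))) + 2"
    by simp
  from divide_right_mono[OF this, of "real l ^ 2"]
  have "mixture_cost n \<kappa> l (H(i := g)) \<le> mixture_cost n \<kappa> l H +
      2 * (real l / real n * (\<Sum>v<n. label_cost l H v (g v) - label_cost l H v (H i v))) / real l ^ 2 + 2 / real l ^ 2"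
    unfolding mixture_cost_def b_def by (simp add: add_divide_distrib)
  moreover have "2 * (real l / real n * D) / real l ^ 2 = 2 / (real l * real n) * D" for D
    using l n by (simp add: power2_eq_square)
  ultimately show ?thesis by simp
qed

end

section \<open>Greedy rounds on random vertices\<close>

definition vertex_samples :: "nat \<Rightarrow> nat \<Rightarrow> nat \<Rightarrow> (nat \<Rightarrow> nat \<Rightarrow> nat) pmf" where
  "vertex_samples n l t = Pi_pmf {..<l} (\<lambda>_. 0) (\<lambda>_. Pi_pmf {..<t} 0 (\<lambda>_. pmf_of_set {..<n}))"

context pair_labelling
begin

lemma label_cost_bounds:
  assumes "\<And>j v. H j v \<in> L" "a \<in> L" "l > 0"
  shows "0 \<le> label_cost l H v a" "label_cost l H v a \<le> 1"
proof -
  show "0 \<le> label_cost l H v a"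
    unfolding label_cost_def using assms cost_bounds
    by (intro divide_nonneg_nonneg sum_nonneg) auto
  have "(\<Sum>j<l. \<kappa> v u a (H j u)) / real l \<le> 1" for u
  proof -
    have "(\<Sum>j<l. \<kappa> v u a (H j u)) \<le> (\<Sum>j<l. 1)"
      using assms cost_bounds by (intro sum_mono) auto
    then show ?thesis using assms(3) by simp
  qed
  then have "(\<Sum>u<n. (\<Sum>j<l. \<kappa> v u a (H j u)) / real l) \<le> (\<Sum>u<n. 1)"
    by (intro sum_mono) auto
  then show "label_cost l H v a \<le> 1"
    unfolding label_cost_def using n by simp
qed

lemma set_pmf_of_vertices: "set_pmf (pmf_of_set {..<n}) = {..<n}"
  using n by (intro set_pmf_of_set) auto

lemma finite_vertex_sample: "finite (set_pmf (Pi_pmf {..<t::nat} (0::nat) (\<lambda>_. pmf_of_set {..<n})))"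
  by (simp add: set_Pi_pmf finite_PiE_dflt set_pmf_of_vertices)

text \<open>If the sample average of every label is within \<open>\<theta>\<close> of its label
  cost, the sampled minimiser loses at most \<open>2 * \<theta>\<close> against \<open>a\<close>;
  otherwise it loses at most 1. Hoeffding's inequality and a union bound over \<open>L\<close>
  control the second case, so a sample size logarithmic in \<open>card L\<close> is enough.\<close>

lemma expectation_greedy_label:
  fixes \<theta> :: real and v :: nat
  assumes H: "\<And>j v. H j v \<in> L" and a: "a \<in> L" and l: "l > 0" and t: "t > 0" and \<theta>: "\<theta> \<ge> 0"
  defines "g \<equiv> \<lambda>y. arg_min_on (\<lambda>j. \<Sum>s<t. \<Sum>i<l. \<kappa> v (y s) j (H i (y s))) L"
  shows "measure_pmf.expectation (Pi_pmf {..<t} 0 (\<lambda>_. pmf_of_set {..<n}))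
      (\<lambda>y. label_cost l H v (g y) - label_cost l H v a) \<le> 2 * \<theta> + 2 * real (card L) * exp (- 2 * real t * \<theta>\<^sup>2)"
proof -
  define P where "P = Pi_pmf {..<t} 0 (\<lambda>_. pmf_of_set {..<n})"
  define h where "h j u = (\<Sum>i<l. \<kappa> v u j (H i u)) / real l" for j u
  define Bad where "Bad j = {y :: nat \<Rightarrow> nat. \<bar>(\<Sum>s<t. h j (y s)) / real t - label_cost l H v j\<bar> > \<theta>}" for j
  have fin: "finite (set_pmf P)"
    unfolding P_def by (rule finite_vertex_sample)
  have int: "integrable (measure_pmf P) f" for f :: "_ \<Rightarrow> real"
    using fin by (rule integrable_measure_pmf_finite)
  have h: "0 \<le> h j u \<and> h j u \<le> 1" if "j \<in> L" for j u
  proof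
    show "0 \<le> h j u"
      unfolding h_def using that H cost_bounds by (intro divide_nonneg_nonneg sum_nonneg) auto
    have "(\<Sum>i<l. \<kappa> v u j (H i u)) \<le> (\<Sum>i<l. 1)"
      using that H cost_bounds by (intro sum_mono) auto
    then show "h j u \<le> 1" unfolding h_def using l by simp
  qed
  have "measure_pmf.expectation (pmf_of_set {..<n}) (h j) = label_cost l H v j" for j
    using n by (subst integral_pmf_of_set) (auto simp: h_def label_cost_def)
  then have Bad: "measure_pmf.prob P (Bad j) \<le> 2 * exp (- 2 * real t * \<theta>\<^sup>2)" if "j \<in> L" for j
    using Hoeffding_Pi_pmf[of "pmf_of_set {..<n}" "h j" t \<theta> 0] h[OF that] t \<theta>
    unfolding Bad_def P_def by simp
  have gL: "g y \<in> L" for y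
    unfolding g_def using L by (rule arg_min_if_finite(1))
  have le: "label_cost l H v (g y) - label_cost l H v a \<le> 2 * \<theta> + indicator (\<Union>j\<in>L. Bad j) y" for y
  proof (cases "y \<in> (\<Union>j\<in>L. Bad j)")
    case True
    then show ?thesis
      using label_cost_bounds[of H a l v] label_cost_bounds[of H "g y" l v] H a l gL[of y] \<theta> by simp
  next
    case False
    then have *: "\<bar>(\<Sum>s<t. h j (y s)) / real t - label_cost l H v j\<bar> \<le> \<theta>" if "j \<in> L" for j
      using that by (auto simp: Bad_def not_less)
    have "(\<Sum>s<t. \<Sum>i<l. \<kappa> v (y s) (g y) (H i (y s))) \<le> (\<Sum>s<t. \<Sum>i<l. \<kappa> v (y s) a (H i (y s)))"
      unfolding g_def using L a by (intro arg_min_least) auto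
    then have "(\<Sum>s<t. h (g y) (y s)) / real t \<le> (\<Sum>s<t. h a (y s)) / real t"
      unfolding h_def by (intro divide_right_mono) (simp_all flip: sum_divide_distrib add: divide_right_mono)
    then show ?thesis
      using *[OF a] *[OF gL[of y]] False by simp
  qed
  have "measure_pmf.expectation P (\<lambda>y. label_cost l H v (g y) - label_cost l H v a) \<le>
      measure_pmf.expectation P (\<lambda>y. 2 * \<theta> + indicator (\<Union>j\<in>L. Bad j) y)"
    by (intro integral_mono int le)
  also have "\<dots> = 2 * \<theta> + measure_pmf.prob P (\<Union>j\<in>L. Bad j)"
    by (subst Bochner_Integration.integral_add) (auto simp: int)
  also have "measure_pmf.prob P (\<Union>j\<in>L. Bad j) \<le> (\<Sum>j\<in>L. measure_pmf.prob P (Bad j))"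
    using L by (intro measure_pmf.finite_measure_subadditive_finite) auto
  also have "\<dots> \<le> (\<Sum>j\<in>L. 2 * exp (- 2 * real t * \<theta>\<^sup>2))"
    by (intro sum_mono Bad)
  finally show ?thesis unfolding P_def by simp
qed

lemma set_vertex_samples:
  "set_pmf (vertex_samples n l t) \<subseteq> PiE_dflt {..<l} (\<lambda>_. 0) (\<lambda>_. PiE_dflt {..<t} 0 (\<lambda>_. {..<n}))"
  unfolding vertex_samples_def
  by (subst set_Pi_pmf) (auto simp: PiE_dflt_def set_Pi_pmf set_pmf_of_vertices)

lemma finite_vertex_samples: "finite (set_pmf (vertex_samples n l t))"
  by (rule finite_subset[OF set_vertex_samples]) auto

lemma vertex_samples_Suc:
  "vertex_samples n (Suc i) t = map_pmf (\<lambda>(y, U). U(i := y))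
     (pair_pmf (Pi_pmf {..<t} 0 (\<lambda>_. pmf_of_set {..<n})) (vertex_samples n i t))"
  unfolding vertex_samples_def lessThan_Suc by (subst Pi_pmf_insert) auto

text \<open>\<open>H i U\<close> is the mixture after \<open>i\<close> rounds. A fresh sample is
  independent of the mixture it is used on, so in each round \<open>expectation_greedy_label\<close>
  bounds the expected linear change and \<open>mixture_cost_update\<close> adds the remainder
  \<open>2 / real l ^ 2\<close>.\<close>

lemma expectation_mixture_cost:
  fixes \<theta> :: real and v :: nat
  assumes f: "\<And>v. f v \<in> L" and l: "l > 0" and t: "t > 0" and \<theta>: "\<theta> \<ge> 0" and i: "i \<le> l"
  defines "H \<equiv> \<lambda>i U j. if j < i then greedy_labellings L \<kappa> l t U (\<lambda>i s. f (U i s)) i j else f"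
  shows "measure_pmf.expectation (vertex_samples n i t) (\<lambda>U. mixture_cost n \<kappa> l (H i U)) \<le>
    pair_cost n \<kappa> f f + real i * (2 / real l * (2 * \<theta> + 2 * real (card L) * exp (- 2 * real t * \<theta>\<^sup>2)) + 2 / real l ^ 2)"
  using i
proof (induction i)
  case 0
  have "mixture_cost n \<kappa> l (H 0 U) = pair_cost n \<kappa> f f" for U
    using l by (simp add: H_def mixture_cost_def power2_eq_square)
  then show ?case by simp
next
  case (Suc i)
  define \<delta> where "\<delta> = 2 * \<theta> + 2 * real (card L) * exp (- 2 * real t * \<theta>\<^sup>2)"
  define c where "c = 2 / real l * \<delta> + 2 / real l ^ 2"
  define P where "P = Pi_pmf {..<t} 0 (\<lambda>_. pmf_of_set {..<n})"
  define g where "g U y v = arg_min_on (\<lambda>j. \<Sum>s<t. \<Sum>i'<l. \<kappa> v (y s) j (H i U i' (y s))) L" for U v and y :: "nat \<Rightarrow> nat"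
  have HL: "H i U j v \<in> L" for U j v
    unfolding H_def using f greedy_labellings_in[OF L] by auto
  have gL: "g U y v \<in> L" for U y v
    unfolding g_def using L by (rule arg_min_if_finite(1))
  have finP: "finite (set_pmf P)"
    unfolding P_def by (rule finite_vertex_sample)
  have intP: "integrable (measure_pmf P) F" for F :: "_ \<Rightarrow> real"
    using finP by (rule integrable_measure_pmf_finite)
  have int: "integrable (measure_pmf (vertex_samples n i t)) F" for F :: "_ \<Rightarrow> real"
    using finite_vertex_samples by (rule integrable_measure_pmf_finite)
  \<comment> \<open>Round \<open>i\<close> replaces one copy of \<open>f\<close> by the greedy
    labelling for the new sample \<open>y\<close>; earlier rounds do not see
    \<open>y\<close>.\<close>
  have upd: "H (Suc i) (U(i := y)) = (H i U)(i := g U y)" for U y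
  proof -
    have eq: "greedy_labellings L \<kappa> l t (U(i := y)) (\<lambda>i' s. f ((U(i := y)) i' s)) i j v =
        greedy_labellings L \<kappa> l t U (\<lambda>i s. f (U i s)) i j v" for j v
      by (rule greedy_labellings_cong[where S = UNIV]) auto
    show ?thesis
    proof (intro ext)
      fix j v
      consider "j < i" | "j = i" | "j > i" by linarith
      then show "H (Suc i) (U(i := y)) j v = ((H i U)(i := g U y)) j v"
      proof cases
        case 1
        then have "j \<noteq> i" by simp
        have "H (Suc i) (U(i := y)) j v =
            greedy_labellings L \<kappa> l t (U(i := y)) (\<lambda>i' s. f ((U(i := y)) i' s)) i j v"
          unfolding H_def using 1 \<open>j \<noteq> i\<close> by (simp del: fun_upd_apply add: fun_upd_other)
        then show ?thesis
          unfolding eq using 1 by (simp add: H_def)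
      next
        case 2
        have "H (Suc i) (U(i := y)) i v = arg_min_on (\<lambda>j. \<Sum>s<t. \<Sum>i'<l. \<kappa> v (y s) j
            (if i' < i then greedy_labellings L \<kappa> l t (U(i := y)) (\<lambda>i' s. f ((U(i := y)) i' s)) i i' (y s)
             else f (y s))) L"
          unfolding H_def by (simp only: lessI if_True greedy_labellings.simps fun_upd_same)
        also have "\<dots> = g U y v"
          unfolding eq g_def H_def by (intro arg_cong2[where f = arg_min_on] refl ext sum.cong) auto
        finally show ?thesis using 2 by simp
      qed (simp add: H_def)
    qed
  qed
  have step: "measure_pmf.expectation P (\<lambda>y. mixture_cost n \<kappa> l (H (Suc i) (U(i := y)))) \<le>
      mixture_cost n \<kappa> l (H i U) + (2 / real l * \<delta> + 2 / real l ^ 2)" for U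
  proof -
    have "measure_pmf.expectation P (\<lambda>y. mixture_cost n \<kappa> l (H (Suc i) (U(i := y)))) \<le>
        measure_pmf.expectation P (\<lambda>y. mixture_cost n \<kappa> l (H i U) +
          2 / (real l * real n) * (\<Sum>v<n. label_cost l (H i U) v (g U y v) - label_cost l (H i U) v (f v)) + 2 / real l ^ 2)"
    proof (intro integral_mono intP)
      fix y
      have "H i U i = f" by (simp add: H_def)
      then show "mixture_cost n \<kappa> l (H (Suc i) (U(i := y))) \<le> mixture_cost n \<kappa> l (H i U) +
          2 / (real l * real n) * (\<Sum>v<n. label_cost l (H i U) v (g U y v) - label_cost l (H i U) v (f v)) + 2 / real l ^ 2"
        using mixture_cost_update[where H = "H i U" and g = "g U y" and i = i and l = l] HL gL Suc.prems
        unfolding upd by simp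
    qed
    also have "\<dots> = mixture_cost n \<kappa> l (H i U) + 2 / (real l * real n) *
        (\<Sum>v<n. measure_pmf.expectation P (\<lambda>y. label_cost l (H i U) v (g U y v) - label_cost l (H i U) v (f v))) + 2 / real l ^ 2"
      by (simp add: Bochner_Integration.integral_add Bochner_Integration.integral_sum intP
          del: Bochner_Integration.integral_diff)
    also have "\<dots> \<le> mixture_cost n \<kappa> l (H i U) + 2 / (real l * real n) * (\<Sum>v<n. \<delta>) + 2 / real l ^ 2"
    proof -
      have "measure_pmf.expectation P (\<lambda>y. label_cost l (H i U) v (g U y v) - label_cost l (H i U) v (f v)) \<le> \<delta>" for v
        unfolding P_def \<delta>_def g_def using HL f l t \<theta> by (intro expectation_greedy_label) auto
      then have "(\<Sum>v<n. measure_pmf.expectation P (\<lambda>y. label_cost l (H i U) v (g U y v) - label_cost l (H i U) v (f v))) \<le> (\<Sum>v<n. \<delta>)"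
        by (intro sum_mono)
      then show ?thesis by (intro add_mono mult_left_mono) auto
    qed
    finally show ?thesis using n l by simp
  qed
  \<comment> \<open>The sample of round \<open>i\<close> may be drawn after all earlier ones, so the
    expectation can be iterated.\<close>
  have "measure_pmf.expectation (vertex_samples n (Suc i) t) (\<lambda>U. mixture_cost n \<kappa> l (H (Suc i) U)) =
      measure_pmf.expectation (vertex_samples n i t)
        (\<lambda>U. measure_pmf.expectation P (\<lambda>y. mixture_cost n \<kappa> l (H (Suc i) (U(i := y)))))"
  proof -
    have "vertex_samples n (Suc i) t = bind_pmf (vertex_samples n i t) (\<lambda>U. map_pmf (\<lambda>y. U(i := y)) P)"
      unfolding vertex_samples_Suc P_def[symmetric]
      by (subst pair_commute_pmf) (simp add: pair_pmf_def map_bind_pmf map_pmf_def bind_assoc_pmf bind_return_pmf)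
    then have "measure_pmf.expectation (vertex_samples n (Suc i) t) (\<lambda>U. mixture_cost n \<kappa> l (H (Suc i) U)) =
       measure_pmf.expectation (vertex_samples n i t)
        (\<lambda>U. measure_pmf.expectation (map_pmf (\<lambda>y. U(i := y)) P) (\<lambda>U. mixture_cost n \<kappa> l (H (Suc i) U)))"
      using finP finite_vertex_samples
      by (simp only:) (subst pmf_expectation_bind[where A = "set_pmf (vertex_samples n i t)"],
        auto simp: integral_measure_pmf_real[where A = "set_pmf (vertex_samples n i t)"] mult_ac
        intro!: sum.cong)
    then show ?thesis by simp
  qed
  also have "\<dots> \<le> measure_pmf.expectation (vertex_samples n i t)
      (\<lambda>U. mixture_cost n \<kappa> l (H i U) + (2 / real l * \<delta> + 2 / real l ^ 2))"
    by (intro integral_mono int step)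
  also have "\<dots> = measure_pmf.expectation (vertex_samples n i t) (\<lambda>U. mixture_cost n \<kappa> l (H i U)) +
      (2 / real l * \<delta> + 2 / real l ^ 2)"
    by (simp add: Bochner_Integration.integral_add int)
  also have "\<dots> \<le> pair_cost n \<kappa> f f + real i * (2 / real l * \<delta> + 2 / real l ^ 2) + (2 / real l * \<delta> + 2 / real l ^ 2)"
    using Suc unfolding \<delta>_def by simp
  finally show ?case
    unfolding \<delta>_def[symmetric] c_def[symmetric] by (simp add: distrib_right)
qed

end

section \<open>Estimating mixture costs on random pairs\<close>

definition pair_samples :: "nat \<Rightarrow> nat \<Rightarrow> (nat \<Rightarrow> nat \<times> nat) pmf" where
  "pair_samples n m = Pi_pmf {..<m} (0, 0) (\<lambda>_. pmf_of_set ({..<n} \<times> {..<n}))"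

context pair_labelling
begin

text \<open>A uniformly random ordered pair, equal entries allowed, has the mixture cost as its
  expected averaged cost, so Hoeffding's inequality applies.\<close>

lemma sampled_cost_deviation:
  assumes H: "\<And>i v. i < l \<Longrightarrow> H i v \<in> L" and "l > 0" "m > 0" "e \<ge> 0"
  shows "measure_pmf.prob (pair_samples n m) {W. \<bar>sampled_cost \<kappa> l m H W - mixture_cost n \<kappa> l H\<bar> > e}
    \<le> 2 * exp (- 2 * real m * e\<^sup>2)"
proof -
  define h where "h p = (\<Sum>i<l. \<Sum>j<l. \<kappa> (fst p) (snd p) (H i (fst p)) (H j (snd p))) / real l ^ 2"
    for p :: "nat \<times> nat"
  have "0 \<le> h p" for p
    unfolding h_def using H cost_bounds by (intro divide_nonneg_nonneg sum_nonneg) auto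
  moreover have "h p \<le> 1" for p
  proof -
    have "(\<Sum>i<l. \<Sum>j<l. \<kappa> (fst p) (snd p) (H i (fst p)) (H j (snd p))) \<le> (\<Sum>i<l. \<Sum>j<l. 1)"
      using H cost_bounds by (intro sum_mono) auto
    then show ?thesis using \<open>l > 0\<close> by (simp add: h_def power2_eq_square)
  qed
  moreover have "measure_pmf.expectation (pmf_of_set ({..<n} \<times> {..<n})) h = mixture_cost n \<kappa> l H"
  proof -
    have "measure_pmf.expectation (pmf_of_set ({..<n} \<times> {..<n})) h = sum h ({..<n} \<times> {..<n}) / real (card ({..<n} \<times> {..<n}))"
      using n by (intro integral_pmf_of_set) auto
    also have "\<dots> = (\<Sum>u<n. \<Sum>v<n. h (u, v)) / real n ^ 2"
      by (simp add: sum.cartesian_product power2_eq_square)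
    also have "\<dots> = (\<Sum>u<n. \<Sum>v<n. \<Sum>i<l. \<Sum>j<l. \<kappa> u v (H i u) (H j v)) / real l ^ 2 / real n ^ 2"
      by (simp add: h_def flip: sum_divide_distrib)
    also have "\<dots> = mixture_cost n \<kappa> l H"
      unfolding mixture_cost_def pair_cost_def
      by (subst sum_swap_pairs) (simp flip: sum_divide_distrib)
    finally show ?thesis .
  qed
  ultimately show ?thesis
    using Hoeffding_Pi_pmf[of "pmf_of_set ({..<n} \<times> {..<n})" h m e "(0, 0)"] assms(3,4)
    unfolding pair_samples_def sampled_cost_def h_def by simp
qed

text \<open>Markov's inequality for the excess over the optimum, which is nonnegative by
  \<open>mixture_cost_rounding\<close> and has expectation at most \<open>e / 6\<close>.\<close>

lemma prob_mixture_cost_exceeds: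
  fixes \<theta> e :: real
  assumes f: "\<And>v. f v \<in> L"
    and opt: "\<And>g. (\<And>v. g v \<in> L) \<Longrightarrow> pair_cost n \<kappa> f f \<le> pair_cost n \<kappa> g g"
    and pos: "l > 0" "t > 0" "\<theta> \<ge> 0" "e > 0"
    and small: "4 * \<theta> + 4 * real (card L) * exp (- 2 * real t * \<theta>\<^sup>2) + 2 / real l \<le> e / 6"
  shows "measure_pmf.prob (vertex_samples n l t)
      {U. mixture_cost n \<kappa> l (greedy_labellings L \<kappa> l t U (\<lambda>i s. f (U i s)) l) > pair_cost n \<kappa> f f + e} \<le> 1 / 6"
proof -
  define M where "M = vertex_samples n l t"
  define \<Phi> where "\<Phi> U = mixture_cost n \<kappa> l (greedy_labellings L \<kappa> l t U (\<lambda>i s. f (U i s)) l)" for U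
  let ?o = "pair_cost n \<kappa> f f"
  have int: "integrable (measure_pmf M) F" for F :: "_ \<Rightarrow> real"
    unfolding M_def using finite_vertex_samples by (rule integrable_measure_pmf_finite)
  have lower: "?o \<le> \<Phi> U" for U
  proof -
    obtain g where "\<forall>v. g v \<in> L" "pair_cost n \<kappa> g g \<le> \<Phi> U"
      using mixture_cost_rounding[of l "greedy_labellings L \<kappa> l t U (\<lambda>i s. f (U i s)) l"]
        greedy_labellings_in[OF L] pos(1) unfolding \<Phi>_def by auto
    then show ?thesis using opt[of g] by auto
  qed
  have "measure_pmf.prob M {U. \<Phi> U > ?o + e} = measure_pmf.expectation M (indicator {U. \<Phi> U > ?o + e})"
    by simp
  also have "\<dots> \<le> measure_pmf.expectation M (\<lambda>U. (\<Phi> U - ?o) / e)"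
  proof (intro integral_mono int)
    fix U show "indicator {U. \<Phi> U > ?o + e} U \<le> (\<Phi> U - ?o) / e"
      using lower[of U] pos(4) by (auto simp: indicator_def field_simps)
  qed
  also have "\<dots> = (measure_pmf.expectation M \<Phi> - ?o) / e"
    by (simp add: Bochner_Integration.integral_diff int)
  also have "\<dots> \<le> (e / 6) / e"
  proof (rule divide_right_mono)
    have "mixture_cost n \<kappa> l (\<lambda>j. if j < l then greedy_labellings L \<kappa> l t U (\<lambda>i s. f (U i s)) l j else f) = \<Phi> U" for U
      by (simp add: \<Phi>_def mixture_cost_def)
    then have "measure_pmf.expectation M \<Phi> \<le> ?o + real l * (2 / real l * (2 * \<theta> +
        2 * real (card L) * exp (- 2 * real t * \<theta>\<^sup>2)) + 2 / real l ^ 2)"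
      using expectation_mixture_cost[of f l t \<theta> l] f pos unfolding M_def by simp
    also have "real l * (2 / real l * (2 * \<theta> + 2 * real (card L) * exp (- 2 * real t * \<theta>\<^sup>2)) + 2 / real l ^ 2)
       = 4 * \<theta> + 4 * real (card L) * exp (- 2 * real t * \<theta>\<^sup>2) + 2 / real l"
    proof -
      have "real l * (2 / real l * (2 * \<theta> + 2 * c) + 2 / real l ^ 2) = 4 * \<theta> + 4 * c + 2 / real l" for c
        using pos(1) by (simp add: field_simps power2_eq_square)
      from this[of "real (card L) * exp (- 2 * real t * \<theta>\<^sup>2)"] show ?thesis
        by (simp add: mult.assoc)
    qed
    finally show "measure_pmf.expectation M \<Phi> - ?o \<le> e / 6"
      using small by simp
  qed (use pos in auto)
  finally show ?thesis using pos unfolding M_def \<Phi>_def by simp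
qed

text \<open>Two events of probability at most \<open>1 / 6\<close> have to be avoided: that the
  mixture for the correct guess is too expensive, and that the sampled cost for some guess is off by
  more than \<open>e\<close>. The hypothesis \<open>many\<close> pays for the union bound over the
  \<open>card L ^ (t * l)\<close> guesses.\<close>

lemma prob_estimate_close:
  fixes \<theta> e :: real
  assumes f: "\<And>v. f v \<in> L"
    and opt: "\<And>g. (\<And>v. g v \<in> L) \<Longrightarrow> pair_cost n \<kappa> f f \<le> pair_cost n \<kappa> g g"
    and pos: "l > 0" "t > 0" "m > 0" "\<theta> \<ge> 0" "e > 0"
    and small: "4 * \<theta> + 4 * real (card L) * exp (- 2 * real t * \<theta>\<^sup>2) + 2 / real l \<le> e / 6"
    and many: "real (card L) ^ (t * l) * (2 * exp (- 2 * real m * e\<^sup>2)) \<le> 1 / 6"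
  shows "measure_pmf.prob (pair_pmf (vertex_samples n l t) (pair_samples n m))
      {(U, W). \<bar>estimate L \<kappa> l t m U W - pair_cost n \<kappa> f f\<bar> \<le> 2 * e} \<ge> 2 / 3"
proof -
  define M where "M = vertex_samples n l t"
  define \<Lambda>s where "\<Lambda>s = ({..<l} \<rightarrow>\<^sub>E {..<t} \<rightarrow>\<^sub>E L)"
  define G where "G U \<Lambda> = greedy_labellings L \<kappa> l t U \<Lambda> l" for U \<Lambda>
  let ?o = "pair_cost n \<kappa> f f"
  have fin: "finite \<Lambda>s" unfolding \<Lambda>s_def using L by (intro finite_PiE) auto
  have card: "card \<Lambda>s = card L ^ (t * l)"
    unfolding \<Lambda>s_def by (simp add: card_PiE power_mult)
  have GL: "G U \<Lambda> i v \<in> L" if "i < l" for U \<Lambda> i v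
    unfolding G_def using L that by (rule greedy_labellings_in)
  define Bad1 where "Bad1 = {U. mixture_cost n \<kappa> l (G U (\<lambda>i s. f (U i s))) > ?o + e}"
  define Bad2 where "Bad2 U = (\<Union>\<Lambda>\<in>\<Lambda>s. {W. \<bar>sampled_cost \<kappa> l m (G U \<Lambda>) W - mixture_cost n \<kappa> l (G U \<Lambda>)\<bar> > e})" for U
  have 1: "measure_pmf.prob M Bad1 \<le> 1 / 6"
    unfolding M_def Bad1_def G_def using f opt pos small by (intro prob_mixture_cost_exceeds) auto
  have 2: "measure_pmf.prob (pair_samples n m) {W. W \<in> Bad2 U} \<le> 1 / 6" for U
  proof -
    have "measure_pmf.prob (pair_samples n m) {W. W \<in> Bad2 U} \<le>
        (\<Sum>\<Lambda>\<in>\<Lambda>s. measure_pmf.prob (pair_samples n m) {W. \<bar>sampled_cost \<kappa> l m (G U \<Lambda>) W - mixture_cost n \<kappa> l (G U \<Lambda>)\<bar> > e})"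
      unfolding Bad2_def Collect_mem_eq using fin by (intro measure_pmf.finite_measure_subadditive_finite) auto
    also have "\<dots> \<le> (\<Sum>\<Lambda>\<in>\<Lambda>s. 2 * exp (- 2 * real m * e\<^sup>2))"
      using GL pos by (intro sum_mono sampled_cost_deviation) auto
    finally show ?thesis using many by (simp add: card)
  qed
  have good: "\<bar>estimate L \<kappa> l t m U W - ?o\<bar> \<le> 2 * e" if U: "U \<notin> Bad1" and W: "W \<notin> Bad2 U" for U W
  proof -
    have dev: "\<bar>sampled_cost \<kappa> l m (G U \<Lambda>) W - mixture_cost n \<kappa> l (G U \<Lambda>)\<bar> \<le> e" if "\<Lambda> \<in> \<Lambda>s" for \<Lambda>
      using W that unfolding Bad2_def by auto
    have est: "estimate L \<kappa> l t m U W = Min ((\<lambda>\<Lambda>. sampled_cost \<kappa> l m (G U \<Lambda>) W) ` \<Lambda>s)"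
      unfolding estimate_def G_def \<Lambda>s_def ..
    \<comment> \<open>The correct guess, restricted so that it is one of the finitely many that are
      tried.\<close>
    define \<Lambda> where "\<Lambda> = (\<lambda>i\<in>{..<l}. \<lambda>s\<in>{..<t}. f (U i s))"
    have \<Lambda>: "\<Lambda> \<in> \<Lambda>s" unfolding \<Lambda>_def \<Lambda>s_def using f by auto
    have "G U \<Lambda> = G U (\<lambda>i s. f (U i s))"
    proof (intro ext)
      fix i v show "G U \<Lambda> i v = G U (\<lambda>i s. f (U i s)) i v"
        unfolding G_def by (rule greedy_labellings_cong[where S = UNIV]) (auto simp: \<Lambda>_def)
    qed
    then have "mixture_cost n \<kappa> l (G U \<Lambda>) \<le> ?o + e"
      using U by (simp add: Bad1_def)
    then have "sampled_cost \<kappa> l m (G U \<Lambda>) W \<le> ?o + 2 * e"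
      using dev[OF \<Lambda>] by linarith
    then have "estimate L \<kappa> l t m U W \<le> ?o + 2 * e"
      unfolding est using fin \<Lambda> by (intro order_trans[OF Min_le]) auto
    \<comment> \<open>No guess can undercut the optimum by more than \<open>e\<close>, because its
      mixture costs at least as much as some labelling.\<close>
    moreover have "?o - e \<le> sampled_cost \<kappa> l m (G U \<Lambda>') W" if "\<Lambda>' \<in> \<Lambda>s" for \<Lambda>'
    proof -
      obtain g where "\<forall>v. g v \<in> L" "pair_cost n \<kappa> g g \<le> mixture_cost n \<kappa> l (G U \<Lambda>')"
        using mixture_cost_rounding[of l "G U \<Lambda>'"] GL pos(1) by blast
      then show ?thesis using opt[of g] dev[OF that] by auto
    qed
    then have "?o - e \<le> estimate L \<kappa> l t m U W"
      unfolding est using fin \<Lambda> by (subst Min_ge_iff) auto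
    ultimately show ?thesis using pos by auto
  qed
  let ?P = "pair_pmf M (pair_samples n m)"
  let ?Good = "{(U, W). \<bar>estimate L \<kappa> l t m U W - ?o\<bar> \<le> 2 * e}"
  have "?Good \<union> (fst -` Bad1 \<union> {(U, W). W \<in> Bad2 U}) = UNIV"
  proof (intro equalityI subsetI)
    fix x :: "(nat \<Rightarrow> nat \<Rightarrow> nat) \<times> (nat \<Rightarrow> nat \<times> nat)"
    obtain U W where "x = (U, W)" by force
    then show "x \<in> ?Good \<union> (fst -` Bad1 \<union> {(U, W). W \<in> Bad2 U})"
      using good[of U W] by auto
  qed simp
  then have "1 = measure_pmf.prob ?P (?Good \<union> (fst -` Bad1 \<union> {(U, W). W \<in> Bad2 U}))"
    by simp
  also have "\<dots> \<le> measure_pmf.prob ?P ?Good + measure_pmf.prob ?P (fst -` Bad1 \<union> {(U, W). W \<in> Bad2 U})"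
    by (intro measure_subadditive) auto
  also have "measure_pmf.prob ?P (fst -` Bad1 \<union> {(U, W). W \<in> Bad2 U}) \<le>
      measure_pmf.prob ?P (fst -` Bad1) + measure_pmf.prob ?P {(U, W). W \<in> Bad2 U}"
    by (intro measure_subadditive) auto
  also have "measure_pmf.prob ?P (fst -` Bad1) = measure_pmf.prob (map_pmf fst ?P) Bad1"
    by simp
  also have "\<dots> \<le> 1 / 6"
    using 1 by (simp only: map_fst_pair_pmf)
  also have "measure_pmf.prob ?P {(U, W). W \<in> Bad2 U} \<le> 1 / 6"
    by (rule prob_pair_pmf_le) (rule 2)
  finally show ?thesis unfolding M_def by simp
qed

lemma optimal_labelling_exists:
  "\<exists>f. (\<forall>v. f v \<in> L) \<and> (\<forall>g. (\<forall>v. g v \<in> L) \<longrightarrow> pair_cost n \<kappa> f f \<le> pair_cost n \<kappa> g g)"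
proof -
  obtain a where a: "a \<in> L" using L by auto
  let ?P = "{..<n} \<rightarrow>\<^sub>E L"
  have fin: "finite ?P" using L by (intro finite_PiE) auto
  have ne: "?P \<noteq> {}" using L by (simp add: PiE_eq_empty_iff)
  define f0 where "f0 = arg_min_on (\<lambda>f. pair_cost n \<kappa> f f) ?P"
  have f0: "f0 \<in> ?P" unfolding f0_def by (rule arg_min_if_finite(1)[OF fin ne])
  define f where "f v = (if v < n then f0 v else a)" for v
  show ?thesis
  proof (intro exI[of _ f] conjI allI impI)
    show "f v \<in> L" for v using f0 a by (auto simp: f_def)
    fix g :: "nat \<Rightarrow> 'l" assume g: "\<forall>v. g v \<in> L"
    have rg: "restrict g {..<n} \<in> ?P" using g by (subst restrict_PiE_iff) simp
    have "pair_cost n \<kappa> f f = pair_cost n \<kappa> f0 f0"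
      by (simp add: pair_cost_def f_def)
    also have "\<dots> \<le> pair_cost n \<kappa> (restrict g {..<n}) (restrict g {..<n})"
      unfolding f0_def by (rule arg_min_least[OF fin ne rg])
    also have "\<dots> = pair_cost n \<kappa> g g"
      by (simp add: pair_cost_def)
    finally show "pair_cost n \<kappa> f f \<le> pair_cost n \<kappa> g g" .
  qed
qed

end

section \<open>Structure of induced \<open>C\<^sub>4\<close>-free graphs\<close>

text \<open>Applied to the reflexive closure of adjacency. For a reflexive symmetric relation the two
  missing diagonals force the four vertices to be distinct.\<close>

definition C4_free_on :: "'a set \<Rightarrow> ('a \<Rightarrow> 'a \<Rightarrow> bool) \<Rightarrow> bool" where
  "C4_free_on V R \<longleftrightarrow> (\<forall>a\<in>V. \<forall>b\<in>V. \<forall>c\<in>V. \<forall>d\<in>V. R a b \<and> R b c \<and> R c d \<and> R d a \<longrightarrow> R a c \<or> R b d)"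

lemma C4_free_onD:
  "C4_free_on V R \<Longrightarrow> a \<in> V \<Longrightarrow> b \<in> V \<Longrightarrow> c \<in> V \<Longrightarrow> d \<in> V \<Longrightarrow>
    R a b \<Longrightarrow> R b c \<Longrightarrow> R c d \<Longrightarrow> R d a \<Longrightarrow> R a c \<or> R b d"
  unfolding C4_free_on_def by blast

lemma C4_free_on_subset: "C4_free_on V R \<Longrightarrow> W \<subseteq> V \<Longrightarrow> C4_free_on W R"
  unfolding C4_free_on_def by blast

definition adj :: "'a ugraph \<Rightarrow> 'a \<Rightarrow> 'a \<Rightarrow> bool" where
  "adj G u v \<longleftrightarrow> u = v \<or> {u, v} \<in> edges G"

lemma adj_refl [simp]: "adj G u u"
  by (simp add: adj_def)

lemma adj_sym: "adj G u v \<longleftrightarrow> adj G v u"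
  by (auto simp: adj_def insert_commute)

lemma induced_C4_free_iff:
  assumes "simple_graph G"
  shows "G \<in> induced_free C4 \<longleftrightarrow> C4_free_on (verts G) (adj G)"
proof
  assume free: "G \<in> induced_free C4"
  show "C4_free_on (verts G) (adj G)"
    unfolding C4_free_on_def
  proof (intro ballI impI, rule ccontr)
    fix a b c d
    assume V: "a \<in> verts G" "b \<in> verts G" "c \<in> verts G" "d \<in> verts G"
      and cyc: "adj G a b \<and> adj G b c \<and> adj G c d \<and> adj G d a"
      and no: "\<not> (adj G a c \<or> adj G b d)"
    have dist: "a \<noteq> b" "a \<noteq> c" "a \<noteq> d" "b \<noteq> c" "b \<noteq> d" "c \<noteq> d"
      using cyc no adj_sym[of G] by (metis adj_refl)+
    have e: "{a, b} \<in> edges G" "{b, c} \<in> edges G" "{c, d} \<in> edges G" "{d, a} \<in> edges G"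
      "{a, c} \<notin> edges G" "{b, d} \<notin> edges G"
      using cyc no dist by (auto simp: adj_def)
    \<comment> \<open>\<open>graph_iso\<close> also compares pairs with \<open>u = v\<close>, which
      are singletons.\<close>
    have loop: "{x} \<notin> edges G" for x
      using assms unfolding simple_graph_def by fastforce
    define f where "f x = (if x = a then 0 else if x = b then 1 else if x = c then 2 else 3 :: nat)" for x
    have "bij_betw f {a, b, c, d} {0, 1, 2, 3}"
      using dist by (auto simp: bij_betw_def inj_on_def f_def)
    moreover have "{u, v} \<in> edges G \<longleftrightarrow> {f u, f v} \<in> edges C4"
      if "u \<in> {a, b, c, d}" "v \<in> {a, b, c, d}" for u v
      using that dist e loop
      by (auto simp: f_def C4_def doubleton_eq_iff insert_commute)
    ultimately have "graph_iso (induced_subgraph G {a, b, c, d}) C4"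
      unfolding graph_iso_def induced_subgraph_def by (intro exI[of _ f]) (auto simp: C4_def)
    moreover have "{a, b, c, d} \<subseteq> verts G" using V by auto
    ultimately show False using free unfolding induced_free_def by blast
  qed
next
  assume free: "C4_free_on (verts G) (adj G)"
  have False if S: "S \<subseteq> verts G" and iso: "graph_iso (induced_subgraph G S) C4" for S
  proof -
    obtain f where f: "bij_betw f S {0, 1, 2, 3}"
      and e: "\<And>u v. u \<in> S \<Longrightarrow> v \<in> S \<Longrightarrow> {u, v} \<in> edges G \<longleftrightarrow> {f u, f v} \<in> edges C4"
      using iso unfolding graph_iso_def induced_subgraph_def by (auto simp: C4_def)
    have "\<exists>x\<in>S. f x = k" if "k \<in> {0, 1, 2, 3}" for k
      using f that unfolding bij_betw_def by (metis imageE)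
    then obtain a b c d where abcd: "a \<in> S" "b \<in> S" "c \<in> S" "d \<in> S"
      and fs: "f a = 0" "f b = 1" "f c = 2" "f d = 3"
      by (metis insertI1 insertI2)
    have "adj G a b" "adj G b c" "adj G c d" "adj G d a"
      using e[of a b] e[of b c] e[of c d] e[of d a] abcd fs by (auto simp: adj_def C4_def)
    moreover have "\<not> adj G a c" "\<not> adj G b d"
      using e[of a c] e[of b d] abcd fs by (auto simp: adj_def C4_def doubleton_eq_iff)
    ultimately show False
      using free abcd S unfolding C4_free_on_def by blast
  qed
  then show "G \<in> induced_free C4"
    using assms unfolding induced_free_def by blast
qed

section \<open>Almost complete vertex sets and families of large cliques\<close>

definition nonadjacent_pairs :: "('a \<Rightarrow> 'a \<Rightarrow> bool) \<Rightarrow> 'a set \<Rightarrow> ('a \<times> 'a) set" where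
  "nonadjacent_pairs R N = {(u, v). u \<in> N \<and> v \<in> N \<and> \<not> R u v}"

definition clique_on :: "('a \<Rightarrow> 'a \<Rightarrow> bool) \<Rightarrow> 'a set \<Rightarrow> bool" where
  "clique_on R C \<longleftrightarrow> (\<forall>u\<in>C. \<forall>v\<in>C. R u v)"

text \<open>The complement of an induced \<open>C\<^sub>4\<close>-free graph has no induced \<open>2K\<^sub>2\<close>. Hence any two edges of
  a maximal matching in the complement are joined by a further edge there, and \<open>t\<close> matching edges
  witness \<open>t\<^sup>2\<close> nonadjacent ordered pairs.\<close>

lemma C4_free_clique_deletion:
  assumes fin: "finite N" and sym: "\<And>u v. R u v \<longleftrightarrow> R v u"
    and free: "C4_free_on N R"
  shows "\<exists>C. C \<subseteq> N \<and> clique_on R C \<and> card (N - C) ^ 2 \<le> 4 * card (nonadjacent_pairs R N)"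
proof -
  define matching where "matching M \<longleftrightarrow> M \<subseteq> nonadjacent_pairs R N \<and>
    (\<forall>(a, b)\<in>M. \<forall>(c, d)\<in>M. (a, b) \<noteq> (c, d) \<longrightarrow> {a, b} \<inter> {c, d} = {})" for M
  have fnp: "finite (nonadjacent_pairs R N)"
    by (rule finite_subset[of _ "N \<times> N"]) (use fin in \<open>auto simp: nonadjacent_pairs_def\<close>)
  have "finite {M. matching M}"
    by (rule finite_subset[of _ "Pow (nonadjacent_pairs R N)"])
      (use fnp in \<open>simp_all add: matching_def Collect_mono_iff Pow_def\<close>)
  moreover have "{} \<in> {M. matching M}" by (simp add: matching_def)
  ultimately have "\<exists>M\<in>{M. matching M}. \<forall>M'\<in>{M. matching M}. M \<subseteq> M' \<longrightarrow> M = M'"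
    by (metis (no_types, lifting) finite_has_maximal empty_iff)
  then obtain M where M: "matching M" and max: "\<And>M'. matching M' \<Longrightarrow> M \<subseteq> M' \<Longrightarrow> M = M'"
    by (elim bexE) simp
  define S where "S = fst ` M \<union> snd ` M"
  have MN: "M \<subseteq> nonadjacent_pairs R N" using M unfolding matching_def by simp
  have finM: "finite M" using MN fnp by (rule finite_subset)
  have SN: "S \<subseteq> N" using MN unfolding S_def nonadjacent_pairs_def by auto
  have "clique_on R (N - S)"
    unfolding clique_on_def
  proof (intro ballI, rule ccontr)
    \<comment> \<open>A nonadjacent pair avoiding \<open>S\<close> would enlarge the maximal
      matching.\<close>
    fix u v assume uv: "u \<in> N - S" "v \<in> N - S" "\<not> R u v"
    have disj: "{a, b} \<inter> {u, v} = {}" "{u, v} \<inter> {a, b} = {}" if "(a, b) \<in> M" for a b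
      using that uv unfolding S_def by force+
    have "{a, b} \<inter> {c, d} = {}"
      if "(a, b) \<in> insert (u, v) M" "(c, d) \<in> insert (u, v) M" "(a, b) \<noteq> (c, d)" for a b c d
    proof (cases "(a, b) = (u, v) \<or> (c, d) = (u, v)")
      case True
      then show ?thesis using that disj by auto
    next
      case False
      then show ?thesis using M that unfolding matching_def by fast
    qed
    moreover have "insert (u, v) M \<subseteq> nonadjacent_pairs R N"
      using MN uv by (simp add: nonadjacent_pairs_def)
    ultimately have "matching (insert (u, v) M)"
      unfolding matching_def by blast
    then have "(u, v) \<in> M" using max[of "insert (u, v) M"] by auto
    then show False using uv unfolding S_def by force
  qed
  moreover have "N - S \<subseteq> N" by blast
  moreover have "card (N - (N - S)) ^ 2 \<le> 4 * card (nonadjacent_pairs R N)"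
  proof -
    define w where "w p q = (SOME r. r \<in> nonadjacent_pairs R N \<and> fst r \<in> {fst p, snd p} \<and> snd r \<in> {fst q, snd q})"
      for p q :: "'a \<times> 'a"
    have w: "w p q \<in> nonadjacent_pairs R N" "fst (w p q) \<in> {fst p, snd p}" "snd (w p q) \<in> {fst q, snd q}"
      if "p \<in> M" "q \<in> M" for p q
    proof -
      obtain a b c d where pq: "p = (a, b)" "q = (c, d)" by force
      have in_N: "a \<in> N" "b \<in> N" "c \<in> N" "d \<in> N" "\<not> R a b" "\<not> R c d"
        using MN that unfolding pq nonadjacent_pairs_def by auto
      \<comment> \<open>The diagonals \<open>a b\<close> and \<open>c d\<close> of this four-cycle
        are missing, so one of its sides is missing too. The case \<open>p = q\<close> is covered,
        hence all of \<open>M \<times> M\<close> is counted.\<close>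
      have "\<not> (R a c \<and> R c b \<and> R b d \<and> R d a)"
        using C4_free_onD[OF free, of a c b d] in_N by auto
      then have "\<exists>r. r \<in> nonadjacent_pairs R N \<and> fst r \<in> {fst p, snd p} \<and> snd r \<in> {fst q, snd q}"
        using in_N sym unfolding pq nonadjacent_pairs_def by auto
      from someI_ex[OF this] show "w p q \<in> nonadjacent_pairs R N" "fst (w p q) \<in> {fst p, snd p}"
        "snd (w p q) \<in> {fst q, snd q}"
        unfolding w_def by auto
    qed
    have same: "p = p'" if "p \<in> M" "p' \<in> M" "x \<in> {fst p, snd p}" "x \<in> {fst p', snd p'}" for p p' x
    proof (rule ccontr)
      assume "p \<noteq> p'"
      then have "{fst p, snd p} \<inter> {fst p', snd p'} = {}"
        using M that(1,2) unfolding matching_def case_prod_unfold by simp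
      then show False using that by blast
    qed
    \<comment> \<open>The ends of \<open>w p q\<close> lie in \<open>p\<close> and in
      \<open>q\<close>, and the members of a matching are disjoint, so the ends determine
      \<open>p\<close> and \<open>q\<close>.\<close>
    have "inj_on (\<lambda>(p, q). w p q) (M \<times> M)"
    proof (rule inj_onI)
      fix x y assume "x \<in> M \<times> M" "y \<in> M \<times> M" and eq: "(\<lambda>(p, q). w p q) x = (\<lambda>(p, q). w p q) y"
      moreover obtain p q where x: "x = (p, q)" by (cases x)
      moreover obtain p' q' where y: "y = (p', q')" by (cases y)
      ultimately have *: "p \<in> M" "q \<in> M" "p' \<in> M" "q' \<in> M" and eq: "w p q = w p' q'" by auto
      have "p = p'"
        using same[OF *(1,3), of "fst (w p q)"] w(2)[OF *(1,2)] w(2)[OF *(3,4)] eq by simp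
      moreover have "q = q'"
        using same[OF *(2,4), of "snd (w p q)"] w(3)[OF *(1,2)] w(3)[OF *(3,4)] eq by simp
      ultimately show "x = y" unfolding x y by simp
    qed
    moreover have "(\<lambda>(p, q). w p q) ` (M \<times> M) \<subseteq> nonadjacent_pairs R N"
      using w(1) by auto
    ultimately have "card (M \<times> M) \<le> card (nonadjacent_pairs R N)"
      using fnp by (rule card_inj_on_le)
    then have "card M ^ 2 \<le> card (nonadjacent_pairs R N)"
      by (simp add: card_cartesian_product power2_eq_square)
    moreover have "card S \<le> 2 * card M"
      unfolding S_def using card_Un_le[of "fst ` M" "snd ` M"] card_image_le[OF finM, of fst]
        card_image_le[OF finM, of snd] by linarith
    moreover have "N - (N - S) = S" using SN by auto
    ultimately show ?thesis
      using power_mono[of "card S" "2 * card M" 2] by (simp add: power_mult_distrib)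
  qed
  ultimately show ?thesis by (intro exI[of _ "N - S"] conjI)
qed

text \<open>Take a maximal family of disjoint cliques with at least \<open>card V / K\<close>
  vertices each. Disjointness bounds their number by \<open>K\<close>, and a larger clique in the
  remaining set could be added to the family.\<close>

lemma maximal_clique_family:
  assumes fin: "finite V" and V: "V \<noteq> {}"
  obtains X where "\<Union>X \<subseteq> V" "disjoint X" "\<forall>C\<in>X. clique_on R C"
    "finite X" "card X \<le> K"
    "\<forall>C. C \<subseteq> V - \<Union>X \<longrightarrow> clique_on R C \<longrightarrow> K * card C \<le> card V"
proof -
  define fam where "fam X \<longleftrightarrow> \<Union>X \<subseteq> V \<and> disjoint X \<and> (\<forall>C\<in>X. clique_on R C \<and> card V \<le> K * card C)" for X
  have "finite {X. fam X}"
    by (rule finite_subset[of _ "Pow (Pow V)"]) (use fin in \<open>auto simp: fam_def\<close>)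
  moreover have "{} \<in> {X. fam X}" by (simp add: fam_def)
  ultimately have "\<exists>X\<in>{X. fam X}. \<forall>X'\<in>{X. fam X}. X \<subseteq> X' \<longrightarrow> X = X'"
    by (metis (no_types, lifting) finite_has_maximal empty_iff)
  then obtain X where X: "fam X" and max: "\<And>X'. fam X' \<Longrightarrow> X \<subseteq> X' \<Longrightarrow> X = X'"
    by (elim bexE) simp
  have fX: "finite X"
    by (rule finite_subset[of _ "Pow V"]) (use fin X in \<open>auto simp: fam_def\<close>)
  have "card X \<le> K"
  proof -
    have "card X * card V \<le> (\<Sum>C\<in>X. K * card C)"
      using sum_mono[of X "\<lambda>_. card V" "\<lambda>C. K * card C"] X by (simp add: fam_def)
    also have "\<dots> = K * card (\<Union>X)"
      using X fin by (subst card_Union_disjoint)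
        (auto simp: fam_def sum_distrib_left intro: finite_subset[of _ V])
    also have "\<dots> \<le> K * card V"
      using X fin by (intro mult_le_mono2 card_mono) (auto simp: fam_def)
    finally show ?thesis using fin V by (simp add: card_gt_0_iff)
  qed
  moreover have "K * card C \<le> card V" if C: "C \<subseteq> V - \<Union>X" "clique_on R C" for C
  proof (rule ccontr)
    assume *: "\<not> K * card C \<le> card V"
    then have "C \<noteq> {}" by auto
    have "fam (insert C X)"
      using X C * unfolding fam_def by (auto simp: disjoint_def)
    then have "C \<in> X" using max[of "insert C X"] by auto
    then show False using C \<open>C \<noteq> {}\<close> by auto
  qed
  ultimately show ?thesis
    using that[of X] X fX unfolding fam_def by blast
qed

text \<open>Two adjacent vertices have nested neighbourhoods in a clique, so neighbourhoods whose sizes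
  fall into the same bucket are almost equal.\<close>

lemma clique_neighbourhoods_nested:
  assumes sym: "\<And>u v. R u v \<longleftrightarrow> R v u" and free: "C4_free_on V R"
    and in_V: "x \<in> V" "y \<in> V" "B \<subseteq> V" and "R x y" "clique_on R B"
  shows "{z \<in> B. R x z} \<subseteq> {z \<in> B. R y z} \<or> {z \<in> B. R y z} \<subseteq> {z \<in> B. R x z}"
proof (rule ccontr)
  assume "\<not> ?thesis"
  then obtain u v where uv: "u \<in> B" "v \<in> B" "R x u" "\<not> R y u" "R y v" "\<not> R x v" by blast
  then have "R u v" using assms(7) by (auto simp: clique_on_def)
  then show False
    using C4_free_onD[OF free, of x u v y] uv in_V assms(6) sym by blast
qed

lemma clique_neighbourhoods_close:
  assumes sym: "\<And>u v. R u v \<longleftrightarrow> R v u" and free: "C4_free_on V R"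
    and in_V: "x \<in> V" "y \<in> V" "B \<subseteq> V" and "R x y" "clique_on R B" and fin: "finite V"
    and bucket: "card {z \<in> B. R x z} * M div n = card {z \<in> B. R y z} * M div n" and n: "n > 0"
  shows "card {z \<in> B. R x z \<noteq> R y z} * M \<le> n"
proof -
  have *: "card {z \<in> B. R x z \<noteq> R y z} * M \<le> n"
    if sub: "{z \<in> B. R x z} \<subseteq> {z \<in> B. R y z}"
      and b: "card {z \<in> B. R x z} * M div n = card {z \<in> B. R y z} * M div n" for x y
  proof -
    have fB: "finite B" using in_V fin finite_subset by blast
    have "{z \<in> B. R x z \<noteq> R y z} = {z \<in> B. R y z} - {z \<in> B. R x z}" using sub by auto
    then have "card {z \<in> B. R x z \<noteq> R y z} = card {z \<in> B. R y z} - card {z \<in> B. R x z}"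
      using sub fB by (simp add: card_Diff_subset)
    then have "card {z \<in> B. R x z \<noteq> R y z} * M = card {z \<in> B. R y z} * M - card {z \<in> B. R x z} * M"
      by (simp add: diff_mult_distrib)
    also have "\<dots> \<le> n"
    proof -
      let ?p = "card {z \<in> B. R x z} * M" and ?q = "card {z \<in> B. R y z} * M"
      \<comment> \<open>Equal quotients put both products into the same interval of length
        \<open>n\<close>.\<close>
      have "?q = n * (?q div n) + ?q mod n" by simp
      moreover have "n * (?q div n) \<le> ?p" unfolding b[symmetric] by simp
      moreover have "?q mod n < n" using n by simp
      ultimately show ?thesis by linarith
    qed
    finally show ?thesis .
  qed
  have flip: "{z \<in> B. R x z \<noteq> R y z} = {z \<in> B. R y z \<noteq> R x z}" by auto
  show ?thesis
    using clique_neighbourhoods_nested[OF assms(1-7)] *[of x y] *[of y x] bucket unfolding flip by auto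
qed

text \<open>The type of a vertex records the clique containing it and, for every clique
  \<open>B\<close>, which of \<open>M + 1\<close> buckets its number of neighbours in
  \<open>B\<close> falls into. Vertices of equal type are adjacent, so
  \<open>clique_neighbourhoods_close\<close> bounds their disagreement on each of the at most
  \<open>K\<close> cliques by \<open>card V / M\<close>.\<close>

lemma neighbourhood_types:
  assumes sym: "\<And>u v. R u v \<longleftrightarrow> R v u" and free: "C4_free_on V R" and fin: "finite V"
    and X: "\<Union>X \<subseteq> V" "disjoint X" "\<forall>C\<in>X. clique_on R C" "finite X" "card X \<le> K"
  obtains \<tau> :: "'a \<Rightarrow> nat" where
    "\<And>x. x \<in> \<Union>X \<Longrightarrow> \<tau> x < K * (M + 1) ^ K"
    "\<And>x y. x \<in> \<Union>X \<Longrightarrow> y \<in> \<Union>X \<Longrightarrow> \<tau> x = \<tau> y \<Longrightarrow> R x y"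
    "\<And>x y. x \<in> \<Union>X \<Longrightarrow> y \<in> \<Union>X \<Longrightarrow> \<tau> x = \<tau> y \<Longrightarrow>
      card {z \<in> \<Union>X. \<tau> z \<noteq> \<tau> x \<and> R x z \<noteq> R y z} * M \<le> K * card V"
proof -
  define n where "n = card V"
  define part where "part x = (THE C. C \<in> X \<and> x \<in> C)" for x
  have part: "part x \<in> X" "x \<in> part x" if "x \<in> \<Union>X" for x
  proof -
    have "\<exists>!C. C \<in> X \<and> x \<in> C"
      using that X(2) unfolding disjoint_def by blast
    from theI'[OF this] show "part x \<in> X" "x \<in> part x" unfolding part_def by auto
  qed
  define ty where "ty x = (part x, \<lambda>B\<in>X. card {z \<in> B. R x z} * M div n)" for x
  let ?T = "X \<times> (X \<rightarrow>\<^sub>E {..M})"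
  have ty: "ty x \<in> ?T" if x: "x \<in> \<Union>X" for x
  proof -
    have "card {z \<in> B. R x z} * M div n \<le> M" if "B \<in> X" for B
    proof -
      have "card {z \<in> B. R x z} \<le> n"
        unfolding n_def using that X(1) fin by (intro card_mono) auto
      then have "card {z \<in> B. R x z} * M div n \<le> n * M div n"
        by (intro div_le_mono mult_le_mono1)
      also have "\<dots> \<le> M" by simp
      finally show ?thesis .
    qed
    then show ?thesis using part[OF x] by (auto simp: ty_def)
  qed
  have finT: "finite ?T" using X(4) by (intro finite_cartesian_product finite_PiE) auto
  \<comment> \<open>Types are numbered so that patterns can be relations on an initial segment of
    the naturals, independent of the graph.\<close>
  obtain \<iota> where \<iota>: "bij_betw \<iota> ?T {0..<card ?T}"
    using ex_bij_betw_finite_nat[OF finT] by blast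
  have cardT: "card ?T \<le> K * (M + 1) ^ K"
  proof -
    have "card ?T = card X * (M + 1) ^ card X"
      using X(4) by (simp add: card_cartesian_product card_PiE)
    also have "\<dots> \<le> K * (M + 1) ^ K"
      using X(5) by (intro mult_le_mono power_increasing) auto
    finally show ?thesis .
  qed
  define \<tau> where "\<tau> x = \<iota> (ty x)" for x
  have \<tau>_eq: "\<tau> x = \<tau> y \<longleftrightarrow> ty x = ty y" if "x \<in> \<Union>X" "y \<in> \<Union>X" for x y
    unfolding \<tau>_def using inj_on_eq_iff[OF bij_betw_imp_inj_on[OF \<iota>] ty[OF that(1)] ty[OF that(2)]] .
  have 1: "\<tau> x < K * (M + 1) ^ K" if "x \<in> \<Union>X" for x
  proof -
    have "\<iota> (ty x) \<in> {0..<card ?T}" using bij_betw_apply[OF \<iota> ty[OF that]] .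
    then show ?thesis using cardT unfolding \<tau>_def by simp
  qed
  have 2: "R x y" if "x \<in> \<Union>X" "y \<in> \<Union>X" "\<tau> x = \<tau> y" for x y
  proof -
    have "part x = part y" using that \<tau>_eq by (simp add: ty_def)
    then show ?thesis
      using part[OF that(1)] part(2)[OF that(2)] X(3) by (simp add: clique_on_def)
  qed
  have 3: "card {z \<in> \<Union>X. \<tau> z \<noteq> \<tau> x \<and> R x z \<noteq> R y z} * M \<le> K * n"
    if xy: "x \<in> \<Union>X" "y \<in> \<Union>X" "\<tau> x = \<tau> y" for x y
  proof -
    have n: "n > 0" using xy(1) X(1) fin unfolding n_def by (auto simp: card_gt_0_iff)
    have bucket: "card {z \<in> B. R x z} * M div n = card {z \<in> B. R y z} * M div n" if "B \<in> X" for B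
    proof -
      have "snd (ty x) B = snd (ty y) B" using xy \<tau>_eq by simp
      then show ?thesis using that by (simp add: ty_def)
    qed
    have "card {z \<in> B. R x z \<noteq> R y z} * M \<le> n" if "B \<in> X" for B
      using that X xy 2[OF xy] fin n bucket
      by (intro clique_neighbourhoods_close[OF sym free]) auto
    then have "(\<Sum>B\<in>X. card {z \<in> B. R x z \<noteq> R y z} * M) \<le> (\<Sum>B\<in>X. n)"
      by (rule sum_mono)
    also have "\<dots> \<le> K * n" using X(5) by simp
    finally have s: "(\<Sum>B\<in>X. card {z \<in> B. R x z \<noteq> R y z}) * M \<le> K * n"
      by (simp add: sum_distrib_right)
    have "card {z \<in> \<Union>X. \<tau> z \<noteq> \<tau> x \<and> R x z \<noteq> R y z} \<le> card (\<Union>B\<in>X. {z \<in> B. R x z \<noteq> R y z})"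
    proof (rule card_mono)
      show "finite (\<Union>B\<in>X. {z \<in> B. R x z \<noteq> R y z})"
        by (rule finite_subset[OF _ fin]) (use X(1) in auto)
    qed auto
    also have "\<dots> \<le> (\<Sum>B\<in>X. card {z \<in> B. R x z \<noteq> R y z})"
      by (rule card_UN_le[OF X(4)])
    finally show ?thesis
      using s mult_le_mono1 le_trans by blast
  qed
  show ?thesis
    using that[of \<tau>] 1 2 3 unfolding n_def by blast
qed

text \<open>Draw a random representative from each class and let \<open>F\<close> be the adjacency
  of representatives, which inherits symmetry and the absence of induced four-cycles. Moving from a
  pair to the pair of representatives one end at a time costs on average at most \<open>h\<close>
  per vertex for each end, whence the factor 2. Pairs inside a class cost nothing.\<close>

lemma representative_pattern:
  fixes \<tau> :: "'a \<Rightarrow> nat" and h :: real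
  assumes R_refl: "\<And>u. R u u" and sym: "\<And>u v. R u v \<longleftrightarrow> R v u" and free: "C4_free_on X R"
    and fin: "finite X"
    and bound: "\<And>x. x \<in> X \<Longrightarrow> \<tau> x < k"
    and clique: "\<And>x y. x \<in> X \<Longrightarrow> y \<in> X \<Longrightarrow> \<tau> x = \<tau> y \<Longrightarrow> R x y"
    and close: "\<And>x y. x \<in> X \<Longrightarrow> y \<in> X \<Longrightarrow> \<tau> x = \<tau> y \<Longrightarrow>
      real (card {z \<in> X. \<tau> z \<noteq> \<tau> x \<and> R x z \<noteq> R y z}) \<le> h"
  obtains F :: "(nat \<times> nat) set" where "F \<subseteq> {..<k} \<times> {..<k}" "Relation.sym F"
    "C4_free_on UNIV (\<lambda>i j. (i, j) \<in> F)"
    "(\<Sum>x\<in>X. \<Sum>y\<in>X. of_bool (R x y \<noteq> ((\<tau> x, \<tau> y) \<in> F))) \<le> 2 * h * real (card X)"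
proof -
  define I where "I = \<tau> ` X"
  define C where "C i = {x \<in> X. \<tau> x = i}" for i
  define d :: "'a \<Rightarrow> 'a \<Rightarrow> 'a \<Rightarrow> 'a \<Rightarrow> real" where "d x y p q = of_bool (R x y \<noteq> R p q)" for x y p q
  \<comment> \<open>The expected number of pairs between classes \<open>i\<close> and
    \<open>j\<close> whose adjacency changes when every end in class \<open>i\<close> is replaced by
    one random member \<open>p\<close>.\<close>
  define A where "A i j = (\<Sum>p\<in>C i. \<Sum>x\<in>C i. \<Sum>y\<in>C j. d x y p y) / real (card (C i))" for i j
  have finI: "finite I" unfolding I_def using fin by simp
  have finC: "finite (C i)" for i unfolding C_def using fin by simp
  have C_ne: "C i \<noteq> {}" if "i \<in> I" for i using that unfolding I_def C_def by auto
  have pos: "real (card (C i)) > 0" if "i \<in> I" for i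
    using C_ne[OF that] finC[of i] by (simp add: card_gt_0_iff)
  obtain \<rho> where \<rho>: "\<And>i. i \<in> I \<Longrightarrow> \<rho> i \<in> C i"
    and le: "(\<Sum>i\<in>I. \<Sum>j\<in>I - {i}. \<Sum>x\<in>C i. \<Sum>y\<in>C j. d x y (\<rho> i) (\<rho> j)) \<le>
      (\<Sum>i\<in>I. \<Sum>j\<in>I - {i}. (\<Sum>p\<in>C i. \<Sum>q\<in>C j. \<Sum>x\<in>C i. \<Sum>y\<in>C j. d x y p q) /
        (real (card (C i)) * real (card (C j))))"
    by (rule independent_choice_le[of I C "\<lambda>i j p q. \<Sum>x\<in>C i. \<Sum>y\<in>C j. d x y p q"])
      (use finI finC C_ne in auto)
  have pair: "(\<Sum>p\<in>C i. \<Sum>q\<in>C j. \<Sum>x\<in>C i. \<Sum>y\<in>C j. d x y p q) /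
      (real (card (C i)) * real (card (C j))) \<le> A i j + A j i" if ij: "i \<in> I" "j \<in> I" for i j
  proof -
    \<comment> \<open>Triangle inequality through \<open>R p y\<close>.\<close>
    have "(\<Sum>p\<in>C i. \<Sum>q\<in>C j. \<Sum>x\<in>C i. \<Sum>y\<in>C j. d x y p q) \<le>
        (\<Sum>p\<in>C i. \<Sum>q\<in>C j. \<Sum>x\<in>C i. \<Sum>y\<in>C j. d x y p y + d p y p q)"
      by (intro sum_mono) (auto simp: d_def)
    also have "\<dots> = (\<Sum>p\<in>C i. \<Sum>q\<in>C j. \<Sum>x\<in>C i. \<Sum>y\<in>C j. d x y p y) +
        (\<Sum>p\<in>C i. \<Sum>q\<in>C j. \<Sum>x\<in>C i. \<Sum>y\<in>C j. d p y p q)"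
      by (simp add: sum.distrib)
    also have "(\<Sum>p\<in>C i. \<Sum>q\<in>C j. \<Sum>x\<in>C i. \<Sum>y\<in>C j. d x y p y) =
        real (card (C i)) * real (card (C j)) * A i j"
      using pos[OF ij(1)] by (simp add: A_def flip: sum_distrib_left)
    also have "(\<Sum>p\<in>C i. \<Sum>q\<in>C j. \<Sum>x\<in>C i. \<Sum>y\<in>C j. d p y p q) =
        real (card (C i)) * (\<Sum>p\<in>C i. \<Sum>q\<in>C j. \<Sum>y\<in>C j. d p y p q)"
      by (simp flip: sum_distrib_left)
    also have "(\<Sum>p\<in>C i. \<Sum>q\<in>C j. \<Sum>y\<in>C j. d p y p q) = (\<Sum>q\<in>C j. \<Sum>p\<in>C i. \<Sum>y\<in>C j. d p y p q)"
      by (rule sum.swap)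
    also have "\<dots> = (\<Sum>q\<in>C j. \<Sum>y\<in>C j. \<Sum>p\<in>C i. d p y p q)"
      by (rule sum.cong[OF refl], rule sum.swap)
    also have "\<dots> = (\<Sum>q\<in>C j. \<Sum>y\<in>C j. \<Sum>p\<in>C i. d y p q p)"
      by (intro sum.cong refl) (simp add: d_def sym)
    also have "\<dots> = real (card (C j)) * A j i"
      using pos[OF ij(2)] by (simp add: A_def)
    finally show ?thesis
      using pos[OF ij(1)] pos[OF ij(2)] by (simp add: field_simps)
  qed
  have A_sum: "(\<Sum>i\<in>I. \<Sum>j\<in>I - {i}. A i j) \<le> h * real (card X)"
  proof -
    have "(\<Sum>j\<in>I - {i}. A i j) \<le> h * real (card (C i))" if i: "i \<in> I" for i
    proof -
      \<comment> \<open>The hypothesis \<open>close\<close> treats all other classes together, so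
        the error does not grow with the number of classes.\<close>
      have inner: "(\<Sum>j\<in>I - {i}. \<Sum>y\<in>C j. d x y p y) \<le> h" if "p \<in> C i" "x \<in> C i" for p x
      proof -
        have "(\<Sum>j\<in>I - {i}. \<Sum>y\<in>C j. d x y p y) = (\<Sum>y\<in>(\<Union>j\<in>I - {i}. C j). d x y p y)"
          by (rule sum.UNION_disjoint[symmetric]) (use finI finC in \<open>auto simp: C_def\<close>)
        also have "(\<Union>j\<in>I - {i}. C j) = {z \<in> X. \<tau> z \<noteq> i}"
          by (auto simp: C_def I_def)
        also have "(\<Sum>y\<in>{z \<in> X. \<tau> z \<noteq> i}. d x y p y) = real (card {z \<in> X. \<tau> z \<noteq> i \<and> R x z \<noteq> R p z})"
          using fin by (simp add: d_def sum.If_cases of_bool_def Int_def)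
        also have "\<dots> \<le> h"
          using close[of x p] that by (simp add: C_def)
        finally show ?thesis .
      qed
      have "(\<Sum>j\<in>I - {i}. A i j) = (\<Sum>j\<in>I - {i}. \<Sum>p\<in>C i. \<Sum>x\<in>C i. \<Sum>y\<in>C j. d x y p y) / real (card (C i))"
        by (simp add: A_def sum_divide_distrib)
      also have "(\<Sum>j\<in>I - {i}. \<Sum>p\<in>C i. \<Sum>x\<in>C i. \<Sum>y\<in>C j. d x y p y) =
          (\<Sum>p\<in>C i. \<Sum>j\<in>I - {i}. \<Sum>x\<in>C i. \<Sum>y\<in>C j. d x y p y)"
        by (rule sum.swap)
      also have "\<dots> = (\<Sum>p\<in>C i. \<Sum>x\<in>C i. \<Sum>j\<in>I - {i}. \<Sum>y\<in>C j. d x y p y)"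
        by (intro sum.cong refl sum.swap)
      also have "\<dots> \<le> (\<Sum>p\<in>C i. \<Sum>x\<in>C i. h)"
        by (intro sum_mono inner)
      finally show ?thesis
        using pos[OF i] by (simp add: field_simps)
    qed
    then have "(\<Sum>i\<in>I. \<Sum>j\<in>I - {i}. A i j) \<le> (\<Sum>i\<in>I. h * real (card (C i)))"
      by (rule sum_mono)
    also have "\<dots> = h * real (\<Sum>i\<in>I. card (C i))"
      by (simp add: sum_distrib_left)
    also have "(\<Sum>i\<in>I. card (C i)) = card X"
      using sum.image_gen[OF fin, of "\<lambda>_. 1 :: nat" \<tau>] by (simp add: I_def C_def)
    finally show ?thesis .
  qed
  have A_swap: "(\<Sum>i\<in>I. \<Sum>j\<in>I - {i}. A j i) = (\<Sum>i\<in>I. \<Sum>j\<in>I - {i}. A i j)"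
  proof -
    have e: "(\<Sum>i\<in>I. \<Sum>j\<in>I - {i}. g i j) = (\<Sum>i\<in>I. \<Sum>j\<in>I. if i = j then 0 else g i j)" for g :: "nat \<Rightarrow> nat \<Rightarrow> real"
      using finI by (intro sum.cong refl sum.mono_neutral_cong_left) auto
    show ?thesis
      unfolding e by (subst sum.swap) (intro sum.cong refl, auto)
  qed
  \<comment> \<open>Reflexivity of \<open>R\<close> puts the loop \<open>(i, i)\<close> into
    \<open>F\<close> for each \<open>i\<close> in \<open>I\<close>, so every class is meant to be a
    clique.\<close>
  define F where "F = {(i, j). i \<in> I \<and> j \<in> I \<and> R (\<rho> i) (\<rho> j)}"
  have "F \<subseteq> {..<k} \<times> {..<k}" using bound by (auto simp: F_def I_def)
  moreover have "Relation.sym F" using sym by (auto simp: F_def Relation.sym_def)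
  moreover have "C4_free_on UNIV (\<lambda>i j. (i, j) \<in> F)"
    unfolding C4_free_on_def
  proof (intro ballI impI)
    fix a b c e assume *: "(a, b) \<in> F \<and> (b, c) \<in> F \<and> (c, e) \<in> F \<and> (e, a) \<in> F"
    then have I: "a \<in> I" "b \<in> I" "c \<in> I" "e \<in> I"
      and R: "R (\<rho> a) (\<rho> b)" "R (\<rho> b) (\<rho> c)" "R (\<rho> c) (\<rho> e)" "R (\<rho> e) (\<rho> a)"
      by (auto simp: F_def)
    have "\<rho> i \<in> X" if "i \<in> I" for i using \<rho>[OF that] by (simp add: C_def)
    then have "R (\<rho> a) (\<rho> c) \<or> R (\<rho> b) (\<rho> e)"
      using C4_free_onD[OF free _ _ _ _ R] I by blast
    then show "(a, c) \<in> F \<or> (b, e) \<in> F" using I by (auto simp: F_def)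
  qed
  moreover have "(\<Sum>x\<in>X. \<Sum>y\<in>X. of_bool (R x y \<noteq> ((\<tau> x, \<tau> y) \<in> F))) \<le> 2 * h * real (card X)"
  proof -
    define g :: "'a \<Rightarrow> 'a \<Rightarrow> real" where "g x y = of_bool (R x y \<noteq> ((\<tau> x, \<tau> y) \<in> F))" for x y
    have group: "(\<Sum>x\<in>X. G x) = (\<Sum>i\<in>I. \<Sum>x\<in>C i. G x)" for G :: "'a \<Rightarrow> real"
      unfolding I_def C_def by (rule sum.image_gen[OF fin])
    have "(\<Sum>x\<in>X. \<Sum>y\<in>X. g x y) = (\<Sum>i\<in>I. \<Sum>x\<in>C i. \<Sum>j\<in>I. \<Sum>y\<in>C j. g x y)"
      by (simp only: group)
    also have "\<dots> = (\<Sum>i\<in>I. \<Sum>j\<in>I. \<Sum>x\<in>C i. \<Sum>y\<in>C j. g x y)"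
      by (intro sum.cong refl sum.swap)
    also have "\<dots> = (\<Sum>i\<in>I. \<Sum>j\<in>I - {i}. \<Sum>x\<in>C i. \<Sum>y\<in>C j. d x y (\<rho> i) (\<rho> j))"
    proof (rule sum.cong[OF refl])
      fix i assume i: "i \<in> I"
      show "(\<Sum>j\<in>I. \<Sum>x\<in>C i. \<Sum>y\<in>C j. g x y) = (\<Sum>j\<in>I - {i}. \<Sum>x\<in>C i. \<Sum>y\<in>C j. d x y (\<rho> i) (\<rho> j))"
      proof (rule sum.mono_neutral_cong_right)
        have "g x y = 0" if "x \<in> C i" "y \<in> C i" for x y
          using that i clique[of x y] R_refl by (auto simp: g_def F_def C_def)
        then show "\<forall>j\<in>I - (I - {i}). (\<Sum>x\<in>C i. \<Sum>y\<in>C j. g x y) = 0" by auto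
        show "(\<Sum>x\<in>C i. \<Sum>y\<in>C j. g x y) = (\<Sum>x\<in>C i. \<Sum>y\<in>C j. d x y (\<rho> i) (\<rho> j))"
          if "j \<in> I - {i}" for j
          using i that by (intro sum.cong refl) (auto simp: g_def d_def F_def C_def)
      qed (use finI in auto)
    qed
    also have "\<dots> \<le> (\<Sum>i\<in>I. \<Sum>j\<in>I - {i}. A i j + A j i)"
      by (rule order_trans[OF le]) (intro sum_mono pair, auto)
    also have "\<dots> \<le> 2 * h * real (card X)"
      using A_sum A_swap by (simp add: sum.distrib)
    finally show ?thesis unfolding g_def .
  qed
  ultimately show ?thesis using that by blast
qed

section \<open>Labels and approximate labellings\<close>

text \<open>A vertex in \<open>Clique_class F i\<close> belongs to the \<open>i\<close>-th class of a blow-up of the pattern \<open>F\<close> by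
  cliques, one in \<open>Indep_class F T\<close> to an independent set whose members may only be adjacent to the
  classes in the clique \<open>T\<close> of \<open>F\<close>. Labels over different patterns exclude adjacency, so that mixing
  them yields a disjoint union.\<close>

datatype label =
    Clique_class "(nat \<times> nat) set" nat
  | Indep_class "(nat \<times> nat) set" "nat set"

text \<open>\<open>None\<close> leaves the adjacency of the pair free.\<close>

fun required :: "label \<Rightarrow> label \<Rightarrow> bool option" where
  "required (Clique_class F i) (Clique_class F' j) = Some (F = F' \<and> (i, j) \<in> F)"
| "required (Clique_class F i) (Indep_class F' T) = (if F = F' \<and> i \<in> T then None else Some False)"
| "required (Indep_class F' T) (Clique_class F i) = (if F = F' \<and> i \<in> T then None else Some False)"
| "required (Indep_class F T) (Indep_class F' T') = Some False"

definition violated :: "bool \<Rightarrow> label \<Rightarrow> label \<Rightarrow> bool" where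
  "violated r a b \<longleftrightarrow> required a b = Some (\<not> r)"

text \<open>Loops carry meaning: class \<open>i\<close> is a clique if \<open>(i, i)\<close> is in
  \<open>F\<close> and independent otherwise. Since \<open>C4_free_on\<close> also covers quadruples
  with repetitions, it speaks about induced four-cycles in the blow-up, where several vertices may
  share a class.\<close>

definition patterns :: "nat \<Rightarrow> (nat \<times> nat) set set" where
  "patterns k = {F. F \<subseteq> {..<k} \<times> {..<k} \<and> Relation.sym F \<and> C4_free_on UNIV (\<lambda>i j. (i, j) \<in> F)}"

definition labels :: "nat \<Rightarrow> label set" where
  "labels k = {Clique_class F i |F i. F \<in> patterns k \<and> i < k} \<union>
     {Indep_class F T |F T. F \<in> patterns k \<and> T \<subseteq> {..<k} \<and> T \<times> T \<subseteq> F}"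

text \<open>Double counting of nonadjacent pairs with a common neighbour in \<open>Y\<close>. The
  common neighbours of such a pair form a clique, since two nonadjacent ones would complete an
  induced four-cycle. By \<open>small\<close> at most \<open>card V / K\<close> of them lie in
  \<open>Y\<close>.\<close>

lemma nonadjacent_pairs_sum_le:
  fixes V :: "'a set"
  assumes fin: "finite V" and sym: "\<And>u v. R u v \<longleftrightarrow> R v u" and free: "C4_free_on V R" and Y: "Y \<subseteq> V"
    and small: "\<And>C. C \<subseteq> Y \<Longrightarrow> clique_on R C \<Longrightarrow> K * card C \<le> card V"
  shows "K * (\<Sum>y\<in>Y. card (nonadjacent_pairs R {x \<in> V. R y x})) \<le> card V ^ 3"
proof -
  let ?P = "nonadjacent_pairs R V"
  have fP: "finite ?P"
    by (rule finite_subset[of _ "V \<times> V"]) (use fin in \<open>auto simp: nonadjacent_pairs_def\<close>)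
  have fY: "finite Y" using Y fin finite_subset by blast
  have "nonadjacent_pairs R {x \<in> V. R y x} = {p \<in> ?P. R y (fst p) \<and> R y (snd p)}" for y
    by (auto simp: nonadjacent_pairs_def)
  then have "(\<Sum>y\<in>Y. card (nonadjacent_pairs R {x \<in> V. R y x})) =
      (\<Sum>y\<in>Y. card {p \<in> ?P. R y (fst p) \<and> R y (snd p)})" by simp
  also have "\<dots> = (\<Sum>p\<in>?P. card {y \<in> Y. R y (fst p) \<and> R y (snd p)})"
    by (rule sum_multicount_gen[OF fY fP]) simp
  finally have "K * (\<Sum>y\<in>Y. card (nonadjacent_pairs R {x \<in> V. R y x})) =
      (\<Sum>p\<in>?P. K * card {y \<in> Y. R y (fst p) \<and> R y (snd p)})"
    by (simp add: sum_distrib_left)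
  also have "\<dots> \<le> (\<Sum>p\<in>?P. card V)"
  proof (intro sum_mono small)
    fix p assume p: "p \<in> ?P"
    obtain x x' where xx: "p = (x, x')" by (cases p)
    show "clique_on R {y \<in> Y. R y (fst p) \<and> R y (snd p)}"
      unfolding clique_on_def
    proof (intro ballI)
      fix y y' assume "y \<in> {y \<in> Y. R y (fst p) \<and> R y (snd p)}" "y' \<in> {y \<in> Y. R y (fst p) \<and> R y (snd p)}"
      then have "y \<in> V" "y' \<in> V" "R y x" "R y x'" "R y' x" "R y' x'" using Y xx by auto
      moreover have "x \<in> V" "x' \<in> V" "\<not> R x x'" using p xx by (auto simp: nonadjacent_pairs_def)
      ultimately show "R y y'"
        using C4_free_onD[OF free, of y x y' x'] sym by blast
    qed
  qed auto
  also have "\<dots> = card ?P * card V" by simp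
  also have "\<dots> \<le> card V ^ 2 * card V"
  proof (intro mult_le_mono1)
    have "card ?P \<le> card (V \<times> V)"
      by (rule card_mono) (use fin in \<open>auto simp: nonadjacent_pairs_def\<close>)
    then show "card ?P \<le> card V ^ 2" by (simp add: card_cartesian_product power2_eq_square)
  qed
  finally show ?thesis by (simp add: power3_eq_cube power2_eq_square)
qed

text \<open>The bound \<open>t \<le> 2 * sqrt q\<close> is traded for one that is linear in
  \<open>q\<close> and can be summed over vertices, by expanding the square of
  \<open>n / a - t / 2\<close>.\<close>

lemma amgm_square_bound:
  fixes t q a n :: real
  assumes "t\<^sup>2 \<le> 4 * q" "a > 0" "n > 0"
  shows "t \<le> n / a + a / n * q"
proof -
  have "0 \<le> (n / a - t / 2)\<^sup>2" by simp
  then have "n / a * t \<le> (n / a)\<^sup>2 + q"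
    using assms(1) by (simp add: power2_eq_square algebra_simps)
  then have "a / n * (n / a * t) \<le> a / n * ((n / a)\<^sup>2 + q)"
    using assms by (intro mult_left_mono) auto
  moreover have "a / n * (n / a * t) = t" "a / n * ((n / a)\<^sup>2 + q) = n / a + a / n * q"
    using assms by (simp_all add: distrib_left power2_eq_square)
  ultimately show ?thesis by simp
qed

text \<open>Vertices in large cliques are labelled by their type, and each remaining vertex by a
  pattern clique that on average catches almost all of its neighbours among them. With this
  \<open>K\<close> the nonadjacent pairs inside neighbourhoods sum to at most
  \<open>n ^ 3 / (2 * a ^ 2)\<close>, and with this \<open>M\<close> the class error
  \<open>K * n / M\<close> is \<open>n / (4 * a ^ 2)\<close>. The block inside \<open>X\<close>
  costs at most \<open>n ^ 2 / (2 * a ^ 2)\<close> and the three others at most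
  \<open>2 * n ^ 2 / a\<close> each.\<close>

lemma C4_free_labelling:
  fixes V :: "'a set" and a :: nat
  assumes fin: "finite V" and V: "V \<noteq> {}" and R_refl: "\<And>u. R u u" and sym: "\<And>u v. R u v \<longleftrightarrow> R v u"
    and free: "C4_free_on V R" and a: "a > 0"
  defines "K \<equiv> 2 * a\<^sup>2" and "M \<equiv> 8 * a ^ 4"
  obtains f where "\<And>v. f v \<in> labels (K * (M + 1) ^ K)"
    "(\<Sum>u\<in>V. \<Sum>v\<in>V. of_bool (u \<noteq> v \<and> violated (R u v) (f u) (f v))) \<le> 7 / real a * real (card V) ^ 2"
proof -
  define n where "n = real (card V)"
  have n: "n > 0" using fin V by (simp add: n_def card_gt_0_iff)
  have a1: "real a \<ge> 1" using a by simp
  obtain \<X> where \<X>: "\<Union>\<X> \<subseteq> V" "disjoint \<X>" "\<forall>C\<in>\<X>. clique_on R C" "finite \<X>" "card \<X> \<le> K"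
    and small': "\<forall>C. C \<subseteq> V - \<Union>\<X> \<longrightarrow> clique_on R C \<longrightarrow> K * card C \<le> card V"
    by (rule maximal_clique_family[OF fin V, of R K]) (rule that, assumption+)
  have small: "K * card C \<le> card V" if "C \<subseteq> V - \<Union>\<X>" "clique_on R C" for C
    using small' that by blast
  define k where "k = K * (M + 1) ^ K"
  define X where "X = \<Union>\<X>"
  define Y where "Y = V - X"
  have XV: "X \<subseteq> V" "finite X" and YV: "Y \<subseteq> V" "finite Y" and split: "V = X \<union> Y" "X \<inter> Y = {}"
    using \<X>(1) fin finite_subset unfolding X_def Y_def by auto
  from neighbourhood_types[OF sym free fin \<X>, of M]
  obtain \<tau> :: "'a \<Rightarrow> nat" where \<tau>: "\<And>x. x \<in> X \<Longrightarrow> \<tau> x < k"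
    "\<And>x y. x \<in> X \<Longrightarrow> y \<in> X \<Longrightarrow> \<tau> x = \<tau> y \<Longrightarrow> R x y"
    "\<And>x y. x \<in> X \<Longrightarrow> y \<in> X \<Longrightarrow> \<tau> x = \<tau> y \<Longrightarrow>
      card {z \<in> X. \<tau> z \<noteq> \<tau> x \<and> R x z \<noteq> R y z} * M \<le> K * card V"
    unfolding X_def k_def by blast
  define h where "h = n / (4 * real a ^ 2)"
  have close: "real (card {z \<in> X. \<tau> z \<noteq> \<tau> x \<and> R x z \<noteq> R y z}) \<le> h"
    if "x \<in> X" "y \<in> X" "\<tau> x = \<tau> y" for x y
  proof -
    have "real (card {z \<in> X. \<tau> z \<noteq> \<tau> x \<and> R x z \<noteq> R y z} * M) \<le> real (K * card V)"
      using \<tau>(3)[OF that] by (rule of_nat_mono)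
    then have "real (card {z \<in> X. \<tau> z \<noteq> \<tau> x \<and> R x z \<noteq> R y z}) * (8 * real a ^ 4) \<le> 2 * real a ^ 2 * n"
      by (simp add: K_def M_def n_def)
    then show ?thesis
      using a1 by (simp add: h_def field_simps power4_eq_xxxx power2_eq_square)
  qed
  obtain F where F: "F \<subseteq> {..<k} \<times> {..<k}" "Relation.sym F" "C4_free_on UNIV (\<lambda>i j. (i, j) \<in> F)"
    and D: "(\<Sum>x\<in>X. \<Sum>y\<in>X. of_bool (R x y \<noteq> ((\<tau> x, \<tau> y) \<in> F))) \<le> 2 * h * real (card X)"
    by (rule representative_pattern[OF R_refl sym C4_free_on_subset[OF free XV(1)] XV(2) \<tau>(1,2) close])
  define R' where "R' x y \<longleftrightarrow> (\<tau> x, \<tau> y) \<in> F" for x y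
  have R'_sym: "R' x y \<longleftrightarrow> R' y x" for x y
    using F(2) by (auto simp: R'_def Relation.sym_def)
  have R'_free: "C4_free_on S R'" for S
    using F(3) unfolding C4_free_on_def R'_def by blast
  define N where "N y = {x \<in> X. R y x}" for y
  define L where "L y = {x \<in> Y. R y x}" for y
  have finN: "finite (N y)" and finL: "finite (L y)" for y
    using XV YV by (auto simp: N_def L_def)
  \<comment> \<open>The clique is taken with respect to \<open>R'\<close> because its types have to
    form a clique of \<open>F\<close>.\<close>
  have "\<exists>C. C \<subseteq> N y \<and> clique_on R' C \<and> card (N y - C) ^ 2 \<le> 4 * card (nonadjacent_pairs R' (N y))" for y
    by (rule C4_free_clique_deletion[OF finN R'_sym R'_free])
  then obtain C where C: "\<And>y. C y \<subseteq> N y" "\<And>y. clique_on R' (C y)"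
    "\<And>y. card (N y - C y) ^ 2 \<le> 4 * card (nonadjacent_pairs R' (N y))"
    by metis
  \<comment> \<open>Neighbourhoods inside \<open>Y\<close> are almost cliques of \<open>R\<close>,
    and cliques in \<open>Y\<close> are small. So \<open>Y\<close> spans few edges.\<close>
  have "\<exists>C. C \<subseteq> L y \<and> clique_on R C \<and> card (L y - C) ^ 2 \<le> 4 * card (nonadjacent_pairs R (L y))" for y
  proof -
    have "C4_free_on (L y) R"
      by (rule C4_free_on_subset[OF free]) (use YV in \<open>auto simp: L_def\<close>)
    from C4_free_clique_deletion[OF finL sym this] show ?thesis .
  qed
  then obtain E where E: "\<And>y. E y \<subseteq> L y" "\<And>y. clique_on R (E y)"
    "\<And>y. card (L y - E y) ^ 2 \<le> 4 * card (nonadjacent_pairs R (L y))"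
    by metis
  define D where "D = {(x, y). x \<in> X \<and> y \<in> X \<and> R x y \<noteq> R' x y}"
  have finD: "finite D"
    by (rule finite_subset[of _ "X \<times> X"]) (use XV in \<open>auto simp: D_def\<close>)
  have D_sum: "(\<Sum>x\<in>X. \<Sum>y\<in>X. of_bool (R x y \<noteq> R' x y)) = real (card D)"
  proof -
    have "(\<Sum>x\<in>X. \<Sum>y\<in>X. of_bool (R x y \<noteq> R' x y)) = (\<Sum>p\<in>X \<times> X. of_bool (p \<in> D) :: real)"
      unfolding sum.cartesian_product by (intro sum.cong) (auto simp: D_def)
    also have "\<dots> = real (card (X \<times> X \<inter> D))"
      using XV(2) by (simp add: of_bool_def sum.If_cases Int_def)
    also have "X \<times> X \<inter> D = D" by (auto simp: D_def)
    finally show ?thesis .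
  qed
  have D_le: "real (card D) \<le> n\<^sup>2 / (2 * real a ^ 2)"
  proof -
    have "real (card D) \<le> 2 * h * real (card X)"
      using D unfolding D_sum[symmetric] R'_def .
    also have "\<dots> \<le> 2 * h * n"
      using n card_mono[OF fin XV(1)] by (intro mult_left_mono) (auto simp: h_def n_def)
    finally show ?thesis by (simp add: h_def power2_eq_square)
  qed
  define q where "q y = real (card (nonadjacent_pairs R {x \<in> V. R y x}))" for y
  have fin_np: "finite (nonadjacent_pairs R {x \<in> V. R y x})" for y
    by (rule finite_subset[of _ "V \<times> V"]) (use fin in \<open>auto simp: nonadjacent_pairs_def\<close>)
  have q_sum: "(\<Sum>y\<in>Y. q y) \<le> n ^ 3 / (2 * real a ^ 2)"
  proof -
    have "K * (\<Sum>y\<in>Y. card (nonadjacent_pairs R {x \<in> V. R y x})) \<le> card V ^ 3"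
      by (rule nonadjacent_pairs_sum_le[OF fin sym free YV(1)]) (use small in \<open>auto simp: Y_def X_def\<close>)
    then have "real (K * (\<Sum>y\<in>Y. card (nonadjacent_pairs R {x \<in> V. R y x}))) \<le> real (card V ^ 3)"
      by (rule of_nat_mono)
    then show ?thesis
      using a1 by (simp add: q_def K_def n_def field_simps)
  qed
  have cY: "real (card Y) \<le> n"
    using card_mono[OF fin YV(1)] by (simp add: n_def)
  have NC: "real (card (N y - C y)) \<le> n / a + a / n * (q y + real (card D))" for y
  proof -
    \<comment> \<open>A pair that is nonadjacent in \<open>R'\<close> is nonadjacent in
      \<open>R\<close> or belongs to the set \<open>D\<close> of disagreements.\<close>
    have "card (nonadjacent_pairs R' (N y)) \<le> card (nonadjacent_pairs R {x \<in> V. R y x} \<union> D)"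
      by (rule card_mono) (use finD fin_np XV in \<open>auto simp: nonadjacent_pairs_def N_def D_def\<close>)
    also have "\<dots> \<le> card (nonadjacent_pairs R {x \<in> V. R y x}) + card D"
      by (rule card_Un_le)
    finally have le: "card (nonadjacent_pairs R' (N y)) \<le> card (nonadjacent_pairs R {x \<in> V. R y x}) + card D" .
    have "card (N y - C y) ^ 2 \<le> 4 * (card (nonadjacent_pairs R {x \<in> V. R y x}) + card D)"
      using C(3)[of y] le by (rule order_trans[OF _ mult_le_mono2])
    then have "real (card (N y - C y) ^ 2) \<le> real (4 * (card (nonadjacent_pairs R {x \<in> V. R y x}) + card D))"
      by (rule of_nat_mono)
    then show ?thesis
      using n a1 by (intro amgm_square_bound) (auto simp: q_def)
  qed
  have LE: "real (card (L y - E y)) \<le> n / a + a / n * q y" for y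
  proof -
    have "card (nonadjacent_pairs R (L y)) \<le> card (nonadjacent_pairs R {x \<in> V. R y x})"
      by (rule card_mono) (use fin_np YV in \<open>auto simp: nonadjacent_pairs_def L_def\<close>)
    then have "card (L y - E y) ^ 2 \<le> 4 * card (nonadjacent_pairs R {x \<in> V. R y x})"
      by (rule order_trans[OF E(3) mult_le_mono2])
    then have "real (card (L y - E y) ^ 2) \<le> real (4 * card (nonadjacent_pairs R {x \<in> V. R y x}))"
      by (rule of_nat_mono)
    then show ?thesis
      using n a1 by (intro amgm_square_bound) (auto simp: q_def)
  qed
  have E_le: "real (card (E y)) \<le> n / (2 * real a ^ 2)" for y
  proof -
    have "K * card (E y) \<le> card V"
      using E(1,2)[of y] by (intro small) (auto simp: L_def Y_def X_def)
    then have "real (K * card (E y)) \<le> real (card V)" by (rule of_nat_mono)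
    then show ?thesis using a1 by (simp add: K_def n_def field_simps)
  qed
  have q_sum': "a / n * (\<Sum>y\<in>Y. q y) \<le> n\<^sup>2 / (2 * a)"
  proof -
    have "a / n * (\<Sum>y\<in>Y. q y) \<le> a / n * (n ^ 3 / (2 * real a ^ 2))"
      using q_sum n by (intro mult_left_mono) auto
    then show ?thesis using n a1 by (simp add: power3_eq_cube power2_eq_square)
  qed
  have NC_sum: "(\<Sum>y\<in>Y. real (card (N y - C y))) \<le> 2 * n\<^sup>2 / a"
  proof -
    have "(\<Sum>y\<in>Y. real (card (N y - C y))) \<le> (\<Sum>y\<in>Y. n / a + a / n * (q y + real (card D)))"
      by (intro sum_mono NC)
    also have "\<dots> = real (card Y) * (n / a) + (a / n * (\<Sum>y\<in>Y. q y) + real (card Y) * (a / n * real (card D)))"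
      by (simp add: sum.distrib distrib_left sum_distrib_left)
    also have "\<dots> = real (card Y) * (n / a + a / n * real (card D)) + a / n * (\<Sum>y\<in>Y. q y)"
      by (simp only: distrib_left ac_simps)
    also have "\<dots> \<le> n * (n / a + a / n * (n\<^sup>2 / (2 * real a ^ 2))) + n\<^sup>2 / (2 * a)"
      using n a1 cY D_le q_sum' by (intro add_mono mult_mono add_left_mono mult_left_mono) auto
    also have "\<dots> = 2 * n\<^sup>2 / a"
      using n a1 by (simp add: field_simps power2_eq_square)
    finally show ?thesis .
  qed
  have L_sum: "(\<Sum>y\<in>Y. real (card (L y))) \<le> 2 * n\<^sup>2 / a"
  proof -
    have "real (card (L y)) \<le> n / (2 * real a ^ 2) + (n / a + a / n * q y)" for y
    proof -
      have "L y = E y \<union> (L y - E y)" using E(1)[of y] by auto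
      then have "card (L y) \<le> card (E y) + card (L y - E y)"
        using card_Un_le[of "E y" "L y - E y"] by simp
      then have "real (card (L y)) \<le> real (card (E y)) + real (card (L y - E y))"
        by linarith
      then show ?thesis using E_le[of y] LE[of y] by linarith
    qed
    then have "(\<Sum>y\<in>Y. real (card (L y))) \<le> (\<Sum>y\<in>Y. n / (2 * real a ^ 2) + (n / a + a / n * q y))"
      by (intro sum_mono)
    also have "\<dots> = real (card Y) * (n / (2 * real a ^ 2)) + (real (card Y) * (n / a) + a / n * (\<Sum>y\<in>Y. q y))"
      by (simp add: sum.distrib distrib_left sum_distrib_left)
    also have "\<dots> = real (card Y) * (n / (2 * real a ^ 2) + n / a) + a / n * (\<Sum>y\<in>Y. q y)"
      by (simp only: distrib_left ac_simps)
    also have "\<dots> \<le> n * (n / (2 * real a) + n / a) + n\<^sup>2 / (2 * a)"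
    proof -
      have "n / (2 * real a ^ 2) \<le> n / (2 * real a)"
        using n a1 by (intro divide_left_mono) (auto simp: power2_eq_square)
      then show ?thesis
        using n a1 cY q_sum' by (intro add_mono mult_mono) auto
    qed
    also have "\<dots> = 2 * n\<^sup>2 / a"
      using n a1 by (simp add: field_simps power2_eq_square)
    finally show ?thesis .
  qed
  \<comment> \<open>Vertices outside \<open>V\<close> receive the empty clique, so that every value
    is a label.\<close>
  define f where "f v = (if v \<in> X then Clique_class F (\<tau> v)
    else Indep_class F (if v \<in> Y then \<tau> ` C v else {}))" for v
  have CX: "C y \<subseteq> X" for y using C(1)[of y] by (auto simp: N_def)
  have "F \<in> patterns k" using F by (simp add: patterns_def)
  have f_labels: "f v \<in> labels k" for v
  proof -
    have "\<tau> ` C v \<subseteq> {..<k}" using CX[of v] \<tau>(1) by auto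
    moreover have "\<tau> ` C v \<times> \<tau> ` C v \<subseteq> F" using C(2)[of v] by (auto simp: clique_on_def R'_def)
    ultimately show ?thesis
      using \<tau>(1) \<open>F \<in> patterns k\<close> unfolding f_def labels_def by auto
  qed
  define w :: "'a \<Rightarrow> 'a \<Rightarrow> real" where "w u v = of_bool (u \<noteq> v \<and> violated (R u v) (f u) (f v))" for u v
  have fX: "f x = Clique_class F (\<tau> x)" if "x \<in> X" for x using that by (simp add: f_def)
  have fY: "f y = Indep_class F (\<tau> ` C y)" if "y \<in> Y" for y using that split by (auto simp: f_def)
  have wXX: "w u v \<le> of_bool (R u v \<noteq> R' u v)" if "u \<in> X" "v \<in> X" for u v
    using that by (auto simp: w_def violated_def fX R'_def)
  \<comment> \<open>Such a pair is violated only if \<open>x\<close> is a neighbour of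
    \<open>y\<close> whose type does not occur in \<open>C y\<close>.\<close>
  have wYX: "w y x \<le> of_bool (x \<in> N y - C y)" if "x \<in> X" "y \<in> Y" for x y
    using that by (auto simp: w_def violated_def fX fY N_def split: if_splits)
  have wXY: "w x y \<le> of_bool (x \<in> N y - C y)" if "x \<in> X" "y \<in> Y" for x y
    using that sym[of x y] by (auto simp: w_def violated_def fX fY N_def split: if_splits)
  have wYY: "w y z \<le> of_bool (z \<in> L y)" if "y \<in> Y" "z \<in> Y" for y z
    using that by (auto simp: w_def violated_def fY L_def)
  have count: "(\<Sum>x\<in>A. of_bool (x \<in> B) :: real) \<le> real (card B)" if "finite A" "finite B" for A B :: "'a set"
    using that card_mono[of B "A \<inter> B"] by (auto simp: of_bool_def sum.If_cases Int_def)
  have XX: "(\<Sum>u\<in>X. \<Sum>v\<in>X. w u v) \<le> n\<^sup>2 / (2 * real a ^ 2)"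
  proof -
    have "(\<Sum>u\<in>X. \<Sum>v\<in>X. w u v) \<le> real (card D)"
      unfolding D_sum[symmetric] by (intro sum_mono wXX)
    then show ?thesis using D_le by linarith
  qed
  have YX: "(\<Sum>y\<in>Y. \<Sum>x\<in>X. w y x) \<le> 2 * n\<^sup>2 / a"
  proof -
    have "(\<Sum>x\<in>X. w y x) \<le> real (card (N y - C y))" if "y \<in> Y" for y
      using XV(2) finN[of y] that by (intro order_trans[OF sum_mono[OF wYX] count]) auto
    then have "(\<Sum>y\<in>Y. \<Sum>x\<in>X. w y x) \<le> (\<Sum>y\<in>Y. real (card (N y - C y)))"
      by (intro sum_mono)
    then show ?thesis using NC_sum by linarith
  qed
  have XY: "(\<Sum>x\<in>X. \<Sum>y\<in>Y. w x y) \<le> 2 * n\<^sup>2 / a"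
  proof -
    have "(\<Sum>x\<in>X. w x y) \<le> real (card (N y - C y))" if "y \<in> Y" for y
      using XV(2) finN[of y] that by (intro order_trans[OF sum_mono[OF wXY] count]) auto
    then have "(\<Sum>y\<in>Y. \<Sum>x\<in>X. w x y) \<le> (\<Sum>y\<in>Y. real (card (N y - C y)))"
      by (intro sum_mono)
    then show ?thesis using NC_sum by (subst sum.swap) linarith
  qed
  have YY: "(\<Sum>y\<in>Y. \<Sum>z\<in>Y. w y z) \<le> 2 * n\<^sup>2 / a"
  proof -
    have "(\<Sum>z\<in>Y. w y z) \<le> real (card (L y))" if "y \<in> Y" for y
      using YV(2) finL[of y] that by (intro order_trans[OF sum_mono[OF wYY] count]) auto
    then have "(\<Sum>y\<in>Y. \<Sum>z\<in>Y. w y z) \<le> (\<Sum>y\<in>Y. real (card (L y)))"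
      by (intro sum_mono)
    then show ?thesis using L_sum by linarith
  qed
  have "(\<Sum>u\<in>V. \<Sum>v\<in>V. w u v) = (\<Sum>u\<in>X. \<Sum>v\<in>X. w u v) + (\<Sum>x\<in>X. \<Sum>y\<in>Y. w x y) +
      ((\<Sum>y\<in>Y. \<Sum>x\<in>X. w y x) + (\<Sum>y\<in>Y. \<Sum>z\<in>Y. w y z))"
    unfolding split(1) using XV YV split(2) by (simp add: sum.union_disjoint sum.distrib)
  also have "\<dots> \<le> n\<^sup>2 / (2 * real a ^ 2) + 6 * n\<^sup>2 / a"
    using XX XY YX YY by (simp add: field_simps)
  also have "\<dots> \<le> 7 / real a * n\<^sup>2"
  proof -
    have "n\<^sup>2 / (2 * real a ^ 2) \<le> n\<^sup>2 / a"
      using n a1 by (intro divide_left_mono) (auto simp: power2_eq_square)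
    then show ?thesis by simp
  qed
  finally show ?thesis
    using that[of f] f_labels unfolding w_def k_def n_def by blast
qed

section \<open>Distance to induced \<open>C\<^sub>4\<close>-freeness as a labelling cost\<close>

lemma required_sym:
  assumes "a \<in> labels k" "b \<in> labels k"
  shows "required a b = required b a"
  using assms by (cases a; cases b) (auto simp: labels_def patterns_def Relation.sym_def)

lemma violated_sym: "a \<in> labels k \<Longrightarrow> b \<in> labels k \<Longrightarrow> violated r a b = violated r b a"
  by (simp add: violated_def required_sym)

text \<open>The converse direction. A vertex with an independent label lies on no induced
  four-cycle, and on a cycle through clique classes the adjacencies force one common pattern, in
  which the classes would form a forbidden quadruple.\<close>

lemma C4_free_of_labels:
  assumes f: "\<And>v. f v \<in> labels k" and refl: "\<And>u. R u u" and sym: "\<And>u v. R u v \<longleftrightarrow> R v u"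
    and sat: "\<And>u v. u \<in> V \<Longrightarrow> v \<in> V \<Longrightarrow> u \<noteq> v \<Longrightarrow> \<not> violated (R u v) (f u) (f v)"
  shows "C4_free_on V R"
  unfolding C4_free_on_def
proof (intro ballI impI)
  fix a b c d assume V: "a \<in> V" "b \<in> V" "c \<in> V" "d \<in> V"
    and cyc: "R a b \<and> R b c \<and> R c d \<and> R d a"
  show "R a c \<or> R b d"
  proof (rule ccontr)
    assume "\<not> ?thesis"
    then have no: "\<not> R a c" "\<not> R b d" "\<not> R c a" "\<not> R d b" using sym by blast+
    have yes: "R a b" "R b c" "R c d" "R d a" "R b a" "R c b" "R d c" "R a d"
      using cyc sym by blast+
    have dist: "a \<noteq> b" "b \<noteq> c" "c \<noteq> d" "d \<noteq> a" "a \<noteq> c" "b \<noteq> d"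
      using no yes refl by blast+
    txt \<open>The neighbours of an independent vertex lie in a clique, so it is on no induced cycle.\<close>
    have indep: "\<exists>F i. f x = Clique_class F i"
      if x: "x \<in> V" "y \<in> V" "z \<in> V" and R: "R x y" "R x z" "\<not> R y z" and ne: "x \<noteq> y" "x \<noteq> z" "y \<noteq> z"
      for x y z
    proof (cases "f x")
      case (Indep_class F T)
      then have T: "T \<times> T \<subseteq> F" using f[of x] by (auto simp: labels_def)
      have "\<exists>i\<in>T. f y = Clique_class F i" if "y \<in> V" "R x y" "x \<noteq> y" for y
        using sat[OF x(1) that(1,3)] that(2) Indep_class
        by (cases "f y") (auto simp: violated_def split: if_splits)
      then obtain i j where "i \<in> T" "j \<in> T" "f y = Clique_class F i" "f z = Clique_class F j"
        using x R ne by metis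
      then have "violated (R y z) (f y) (f z)"
        using T R by (auto simp: violated_def)
      then show ?thesis using sat[OF x(2,3) ne(3)] by blast
    qed auto
    obtain Fa ia where a: "f a = Clique_class Fa ia"
      using indep[of a b d] V yes no dist by blast
    obtain Fb ib where b: "f b = Clique_class Fb ib"
      using indep[of b a c] V yes no dist by blast
    obtain Fc ic where c: "f c = Clique_class Fc ic"
      using indep[of c b d] V yes no dist by blast
    obtain Fd id where d: "f d = Clique_class Fd id"
      using indep[of d a c] V yes no dist by blast
    have "(Fa = Fb \<and> (ia, ib) \<in> Fa)" "(Fb = Fc \<and> (ib, ic) \<in> Fb)"
      "(Fc = Fd \<and> (ic, id) \<in> Fc)" "(Fd = Fa \<and> (id, ia) \<in> Fd)"
      "\<not> (Fa = Fc \<and> (ia, ic) \<in> Fa)" "\<not> (Fb = Fd \<and> (ib, id) \<in> Fb)"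
      using sat[of a b] sat[of b c] sat[of c d] sat[of d a] sat[of a c] sat[of b d] V dist yes no
      unfolding violated_def a b c d by auto
    moreover have "C4_free_on UNIV (\<lambda>i j. (i, j) \<in> Fa)"
      using f[of a] a by (auto simp: labels_def patterns_def)
    ultimately show False
      using C4_free_onD[of UNIV "\<lambda>i j. (i, j) \<in> Fa" ia ib ic id] by auto
  qed
qed

lemma labels_subset:
  "labels k \<subseteq> (\<lambda>(F, i). Clique_class F i) ` (Pow ({..<k} \<times> {..<k}) \<times> {..<k}) \<union>
     (\<lambda>(F, T). Indep_class F T) ` (Pow ({..<k} \<times> {..<k}) \<times> Pow {..<k})"
  by (auto simp: labels_def patterns_def image_iff)

lemma finite_labels: "finite (labels k)"
  by (rule finite_subset[OF labels_subset]) simp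

text \<open>A label consists of a relation on \<open>k\<close> points and an index or a subset, so
  its number of bits is polynomial in \<open>k\<close>. The sample sizes depend on this exponent
  only.\<close>

lemma card_labels_le: "card (labels k) \<le> 2 ^ (k * k + k + 1)"
proof -
  have "card (labels k) \<le> card ((\<lambda>(F, i). Clique_class F i) ` (Pow ({..<k} \<times> {..<k}) \<times> {..<k})) +
      card ((\<lambda>(F, T). Indep_class F T) ` (Pow ({..<k} \<times> {..<k}) \<times> Pow {..<k}))"
    by (rule order_trans[OF card_mono[OF _ labels_subset] card_Un_le]) simp
  also have "\<dots> \<le> card (Pow ({..<k} \<times> {..<k}) \<times> {..<k}) + card (Pow ({..<k} \<times> {..<k}) \<times> Pow {..<k})"
    by (intro add_mono card_image_le) auto
  also have "\<dots> = 2 ^ (k * k) * (k + 2 ^ k)"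
    by (simp add: card_cartesian_product card_Pow distrib_left)
  also have "\<dots> \<le> 2 ^ (k * k) * (2 ^ k + 2 ^ k)"
    using less_exp[of k] by (intro mult_le_mono2) simp
  finally show ?thesis by (simp add: power_add mult_2 distrib_left)
qed

lemma labels_nonempty: "labels k \<noteq> {}"
proof -
  have "Indep_class {} {} \<in> labels k"
    by (auto simp: labels_def patterns_def C4_free_on_def Relation.sym_def)
  then show ?thesis by blast
qed

section \<open>Comparing edit cost and distance\<close>

definition edit_cost :: "nat ugraph \<Rightarrow> nat \<Rightarrow> nat \<Rightarrow> label \<Rightarrow> label \<Rightarrow> real" where
  "edit_cost G u v a b = of_bool (u \<noteq> v \<and> violated (adj G u v) a b)"

lemma pair_labelling_edit_cost: "n > 0 \<Longrightarrow> pair_labelling n (labels k) (edit_cost G)"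
  by unfold_locales
    (auto simp: finite_labels labels_nonempty edit_cost_def violated_sym adj_sym)

text \<open>Each edge is counted once for each of its two orderings.\<close>

lemma sum_of_bool_edges:
  assumes "finite V" and S: "\<And>e. e \<in> S \<Longrightarrow> e \<subseteq> V \<and> card e = 2"
  shows "(\<Sum>u\<in>V. \<Sum>v\<in>V. of_bool ({u, v} \<in> S)) = 2 * real (card S)"
proof -
  have fS: "finite S"
    by (rule finite_subset[of _ "Pow V"]) (use assms in auto)
  have "(\<Sum>u\<in>V. \<Sum>v\<in>V. of_bool ({u, v} \<in> S)) = (\<Sum>p\<in>V \<times> V. of_bool ({fst p, snd p} \<in> S) :: real)"
    unfolding sum.cartesian_product by (intro sum.cong) auto
  also have "\<dots> = real (card {p \<in> V \<times> V. {fst p, snd p} \<in> S})"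
    using assms(1) by (simp add: of_bool_def sum.If_cases Int_def)
  also have "{p \<in> V \<times> V. {fst p, snd p} \<in> S} = (\<Union>e\<in>S. {p. {fst p, snd p} = e})"
  proof -
    have "fst p \<in> V \<and> snd p \<in> V" if "{fst p, snd p} \<in> S" for p
      using S[OF that] by simp
    then show ?thesis by (auto simp: mem_Times_iff)
  qed
  also have "card \<dots> = (\<Sum>e\<in>S. card {p. {fst p, snd p} = e})"
  proof (rule card_UN_disjoint[OF fS])
    show "\<forall>e\<in>S. finite {p. {fst p, snd p} = e}"
    proof
      fix e assume "e \<in> S"
      then have "finite e" using S assms(1) finite_subset by blast
      then show "finite {p. {fst p, snd p} = e}"
        by (auto intro: finite_subset[of "{p. {fst p, snd p} = e}" "e \<times> e"])
    qed
  qed auto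
  also have "\<dots> = (\<Sum>e\<in>S. 2)"
  proof (rule sum.cong[OF refl])
    fix e assume "e \<in> S"
    then obtain a b where ab: "e = {a, b}" "a \<noteq> b" using S by (metis card_2_iff)
    have "{p. {fst p, snd p} = e} = {(a, b), (b, a)}"
      unfolding ab(1) by (auto simp: doubleton_eq_iff)
    then show "card {p. {fst p, snd p} = e} = 2" using ab(2) by simp
  qed
  finally show ?thesis by simp
qed

lemma graph_dist_eq_sum:
  assumes "simple_graph G" "simple_graph H" "verts H = verts G"
  shows "(\<Sum>u\<in>verts G. \<Sum>v\<in>verts G. of_bool (({u, v} \<in> edges G) \<noteq> ({u, v} \<in> edges H))) / real (card (verts G)) ^ 2
    = 2 * graph_dist G H"
proof -
  let ?D = "(edges G - edges H) \<union> (edges H - edges G)"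
  have fin: "finite (verts G)" using assms by (simp add: simple_graph_def)
  have sub: "e \<subseteq> verts G \<and> card e = 2" if "e \<in> ?D" for e
    using that assms by (auto simp: simple_graph_def)
  have fD: "finite ?D"
    by (rule finite_subset[of _ "Pow (verts G)"]) (use sub fin in auto)
  have "(\<Sum>u\<in>verts G. \<Sum>v\<in>verts G. of_bool (({u, v} \<in> edges G) \<noteq> ({u, v} \<in> edges H))) =
      (\<Sum>u\<in>verts G. \<Sum>v\<in>verts G. of_bool ({u, v} \<in> ?D) :: real)"
    by (intro sum.cong refl) auto
  also have "\<dots> = 2 * real (card ?D)"
    by (rule sum_of_bool_edges[OF fin sub])
  also have "card ?D = card (edges G - edges H) + card (edges H - edges G)"
    using fD by (intro card_Un_disjoint) auto
  finally show ?thesis by (simp add: graph_dist_def)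
qed

lemma property_dist_le:
  assumes "simple_graph G" "H \<in> P" "simple_graph H" "verts H = verts G"
  shows "property_dist G P \<le> graph_dist G H"
  unfolding property_dist_def
  by (rule Min_le[OF finite_property_dist[OF assms(1)]]) (use assms in blast)

text \<open>Change \<open>G\<close> to what the labels require and keep it wherever they leave a
  choice. The resulting graph satisfies all labels, so \<open>C4_free_of_labels\<close> applies, and
  it differs from \<open>G\<close> exactly in the violated pairs.\<close>

lemma property_dist_le_pair_cost:
  assumes G: "simple_graph G" "verts G = {..<n}" and f: "\<And>v. f v \<in> labels k"
  shows "property_dist G (induced_free C4) \<le> pair_cost n (edit_cost G) f f / 2"
proof -
  define B where "B u v = (case required (f u) (f v) of None \<Rightarrow> {u, v} \<in> edges G | Some r \<Rightarrow> r)" for u v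
  have B_sym: "B u v = B v u" for u v
    using required_sym[OF f f, of u v] by (cases "required (f v) (f u)") (auto simp: B_def insert_commute)
  define H where "H = ({..<n}, {{u, v} |u v. u < n \<and> v < n \<and> u \<noteq> v \<and> B u v})"
  have EH: "{u, v} \<in> edges H \<longleftrightarrow> u < n \<and> v < n \<and> u \<noteq> v \<and> B u v" for u v
    using B_sym by (auto simp: H_def doubleton_eq_iff)
  have H: "simple_graph H" "verts H = {..<n}"
    by (auto simp: simple_graph_def H_def)
  have loop: "{u} \<notin> edges G" for u
    using G(1) by (fastforce simp: simple_graph_def)
  have "C4_free_on {..<n} (adj H)"
  proof (rule C4_free_of_labels[OF f])
    fix u v assume "u \<in> {..<n}" "v \<in> {..<n}" "u \<noteq> v"
    then show "\<not> violated (adj H u v) (f u) (f v)"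
      by (cases "required (f u) (f v)") (auto simp: violated_def adj_def EH B_def)
  qed (auto simp: adj_sym)
  then have "H \<in> induced_free C4"
    using induced_C4_free_iff[OF H(1)] H(2) by simp
  then have "property_dist G (induced_free C4) \<le> graph_dist G H"
    using G H by (intro property_dist_le) auto
  also have "\<dots> = (\<Sum>u<n. \<Sum>v<n. of_bool (({u, v} \<in> edges G) \<noteq> ({u, v} \<in> edges H))) / real n ^ 2 / 2"
    using graph_dist_eq_sum[OF G(1) H(1)] G H by simp
  also have "(\<Sum>u<n. \<Sum>v<n. of_bool (({u, v} \<in> edges G) \<noteq> ({u, v} \<in> edges H))) =
      (\<Sum>u<n. \<Sum>v<n. edit_cost G u v (f u) (f v))"
  proof (intro sum.cong refl)
    fix u v assume "u \<in> {..<n}" "v \<in> {..<n}"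
    then show "of_bool (({u, v} \<in> edges G) \<noteq> ({u, v} \<in> edges H)) = edit_cost G u v (f u) (f v)"
      unfolding EH edit_cost_def violated_def B_def adj_def
      using loop[of u] by (cases "required (f u) (f v)") auto
  qed
  finally show ?thesis by (simp add: pair_cost_def)
qed

text \<open>Label a nearest graph \<open>H\<close> with the property by
  \<open>C4_free_labelling\<close>. A pair violated for \<open>G\<close> is violated for
  \<open>H\<close> or is one on which \<open>G\<close> and \<open>H\<close> differ.\<close>

lemma pair_cost_le_property_dist:
  assumes G: "simple_graph G" "verts G = {..<n}" and n: "n > 0" and a: "a > 0"
  defines "k \<equiv> 2 * a\<^sup>2 * (8 * a ^ 4 + 1) ^ (2 * a\<^sup>2)"
  obtains f where "\<And>v. f v \<in> labels k"
    "pair_cost n (edit_cost G) f f \<le> 2 * property_dist G (induced_free C4) + 7 / real a"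
proof -
  let ?S = "{graph_dist G H |H. H \<in> induced_free C4 \<and> simple_graph H \<and> verts H = verts G}"
  \<comment> \<open>The edgeless graph shows that the minimum is attained.\<close>
  have "simple_graph ({..<n}, {})" by (simp add: simple_graph_def)
  moreover have "({..<n}, {}) \<in> induced_free C4" by (rule edgeless_induced_C4_free) simp
  ultimately have "?S \<noteq> {}" using G(2) by fastforce
  then have "property_dist G (induced_free C4) \<in> ?S"
    unfolding property_dist_def by (rule Min_in[OF finite_property_dist[OF G(1)]])
  then obtain H where H: "H \<in> induced_free C4" "simple_graph H" "verts H = {..<n}"
    and dist: "property_dist G (induced_free C4) = graph_dist G H"
    using G(2) by auto
  have free: "C4_free_on {..<n} (adj H)"
    using induced_C4_free_iff[OF H(2)] H by simp
  have ne: "{..<n} \<noteq> {}" using n by auto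
  obtain f where f: "\<And>v. f v \<in> labels (2 * a\<^sup>2 * (8 * a ^ 4 + 1) ^ (2 * a\<^sup>2))"
    and cost: "(\<Sum>u\<in>{..<n}. \<Sum>v\<in>{..<n}. of_bool (u \<noteq> v \<and> violated (adj H u v) (f u) (f v))) \<le>
      7 / real a * real (card {..<n}) ^ 2"
    by (rule C4_free_labelling[OF finite_lessThan ne adj_refl adj_sym free a]) (rule that, assumption+)
  have "(\<Sum>u<n. \<Sum>v<n. edit_cost G u v (f u) (f v)) \<le>
      (\<Sum>u<n. \<Sum>v<n. of_bool (u \<noteq> v \<and> violated (adj H u v) (f u) (f v)) +
        of_bool (({u, v} \<in> edges G) \<noteq> ({u, v} \<in> edges H)))"
    by (intro sum_mono) (auto simp: edit_cost_def adj_def)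
  also have "\<dots> \<le> 7 / real a * real n ^ 2 + (\<Sum>u<n. \<Sum>v<n. of_bool (({u, v} \<in> edges G) \<noteq> ({u, v} \<in> edges H)))"
    using cost by (simp only: sum.distrib card_lessThan add_right_mono)
  finally have "pair_cost n (edit_cost G) f f \<le> (7 / real a * real n ^ 2 +
      (\<Sum>u<n. \<Sum>v<n. of_bool (({u, v} \<in> edges G) \<noteq> ({u, v} \<in> edges H)))) / real n ^ 2"
    unfolding pair_cost_def by (rule divide_right_mono) simp
  also have "\<dots> = 7 / real a + 2 * graph_dist G H"
    using n graph_dist_eq_sum[OF G(1) H(2)] G H by (simp add: add_divide_distrib)
  finally show ?thesis
    using that[of f] f dist unfolding k_def by simp
qed

text \<open>A non-adaptive tree: \<open>S\<close> collects the positive answers, from which the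
  output is computed.\<close>

primrec query_all :: "(nat \<times> nat) list \<Rightarrow> (nat set set \<Rightarrow> real) \<Rightarrow> nat set set \<Rightarrow> query_tree" where
  "query_all [] h S = Output (h S)"
| "query_all (p # ps) h S =
     Query (fst p) (snd p) (query_all ps h (insert {fst p, snd p} S)) (query_all ps h S)"

lemma run_query_all:
  "run_tree (query_all ps h S) G = h (S \<union> {e \<in> edges G. \<exists>p\<in>set ps. e = {fst p, snd p}})"
proof (induction ps arbitrary: S)
  case (Cons p ps)
  have "insert {fst p, snd p} S \<union> {e \<in> edges G. \<exists>p\<in>set ps. e = {fst p, snd p}} =
      S \<union> {e \<in> edges G. \<exists>p\<in>set (p # ps). e = {fst p, snd p}}" if "{fst p, snd p} \<in> edges G"
    using that by auto
  moreover have "S \<union> {e \<in> edges G. \<exists>p\<in>set ps. e = {fst p, snd p}} =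
      S \<union> {e \<in> edges G. \<exists>p\<in>set (p # ps). e = {fst p, snd p}}" if "{fst p, snd p} \<notin> edges G"
    using that by auto
  ultimately show ?case using Cons by simp
qed simp

lemma num_queries_query_all: "num_queries (query_all ps h S) G = length ps"
  by (induction ps arbitrary: S) auto

section \<open>The algorithm\<close>

definition sample_points :: "nat \<Rightarrow> nat \<Rightarrow> nat \<Rightarrow> (nat \<Rightarrow> nat \<Rightarrow> nat) \<Rightarrow> (nat \<Rightarrow> nat \<times> nat) \<Rightarrow> nat list" where
  "sample_points l t m U W =
     map (\<lambda>(i, s). U i s) (List.product [0..<l] [0..<t]) @ map (fst \<circ> W) [0..<m] @ map (snd \<circ> W) [0..<m]"

text \<open>\<open>edit_cost\<close> reads a graph through its edges, so the positive answers
  \<open>S\<close> stand in for the input graph.\<close>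

definition estimate_tree ::
    "nat \<Rightarrow> nat \<Rightarrow> nat \<Rightarrow> nat \<Rightarrow> (nat \<Rightarrow> nat \<Rightarrow> nat) \<Rightarrow> (nat \<Rightarrow> nat \<times> nat) \<Rightarrow> query_tree" where
  "estimate_tree k l t m U W =
     query_all (List.product (sample_points l t m U W) (sample_points l t m U W))
       (\<lambda>S. estimate (labels k) (edit_cost ({}, S)) l t m U W / 2) {}"

text \<open>All pairs of sample points are queried, and by \<open>estimate_cong\<close> the estimate
  is determined by the costs on these pairs.\<close>

lemma run_estimate_tree:
  "run_tree (estimate_tree k l t m U W) G = estimate (labels k) (edit_cost G) l t m U W / 2"
proof -
  define ps where "ps = sample_points l t m U W"
  let ?S = "{e \<in> edges G. \<exists>p\<in>set (List.product ps ps). e = {fst p, snd p}}"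
  have "estimate (labels k) (edit_cost ({}, ?S)) l t m U W = estimate (labels k) (edit_cost G) l t m U W"
  proof (rule estimate_cong[where S = "set ps"])
    show "U i s \<in> set ps" if "i < l" "s < t" for i s
      using that by (auto simp: ps_def sample_points_def intro!: image_eqI[of _ _ "(i, s)"])
    show "fst (W j) \<in> set ps \<and> snd (W j) \<in> set ps" if "j < m" for j
      using that by (auto simp: ps_def sample_points_def)
    show "edit_cost ({}, ?S) u v = edit_cost G u v" if "u \<in> set ps" "v \<in> set ps" for u v
    proof -
      have "\<exists>p\<in>set (List.product ps ps). {u, v} = {fst p, snd p}"
        using that by (intro bexI[of _ "(u, v)"]) auto
      then show ?thesis by (intro ext) (simp add: edit_cost_def adj_def)
    qed
  qed
  then show ?thesis
    by (simp add: estimate_tree_def run_query_all ps_def)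
qed

lemma num_queries_estimate_tree: "num_queries (estimate_tree k l t m U W) G = (l * t + 2 * m)\<^sup>2"
  by (simp add: estimate_tree_def num_queries_query_all sample_points_def power2_eq_square mult_2)

text \<open>The bound of \<open>pair_cost_le_property_dist\<close> for \<open>a = 14 * N\<close>,
  which makes the structural error \<open>7 / a\<close> equal to \<open>1 / (2 * N)\<close>.\<close>

definition num_classes :: "nat \<Rightarrow> nat" where
  "num_classes N = 2 * (14 * N)\<^sup>2 * (8 * (14 * N) ^ 4 + 1) ^ (2 * (14 * N)\<^sup>2)"

text \<open>The exponent in \<open>card_labels_le\<close>.\<close>

definition label_bits :: "nat \<Rightarrow> nat" where
  "label_bits N = num_classes N * num_classes N + num_classes N + 1"

text \<open>Chosen so that the error \<open>2 / l\<close> of the greedy rounds is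
  \<open>1 / (36 * N)\<close>.\<close>

definition num_rounds :: "nat \<Rightarrow> nat" where
  "num_rounds N = 72 * N"

text \<open>For \<open>\<theta> = 1 / (144 * N)\<close> the exponent \<open>t * \<theta> ^ 2\<close>
  becomes \<open>label_bits N + 144 * N\<close>: the first summand beats the number of labels, the
  second makes the rest small.\<close>

definition round_size :: "nat \<Rightarrow> nat" where
  "round_size N = (144 * N)\<^sup>2 * (label_bits N + 144 * N)"

text \<open>For \<open>e = 1 / (2 * N)\<close> the exponent \<open>m * e ^ 2\<close> has one summand
  for the number of guesses, and 12 for the failure probability \<open>1 / 6\<close>.\<close>

definition num_pairs :: "nat \<Rightarrow> nat" where
  "num_pairs N = 4 * N\<^sup>2 * (label_bits N * (round_size N * num_rounds N) + 12)"

text \<open>The least labelling cost lies between twice the distance and this plus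
  \<open>1 / (2 * N)\<close>, and sampling errs by at most \<open>2 * e = 1 / N\<close>. After
  halving, the total error is at most \<open>3 / (4 * N)\<close>.\<close>

lemma prob_estimate_property_dist:
  assumes G: "simple_graph G" "verts G = {..<n}" and n: "n > 0" and N: "N > 0"
  shows "measure_pmf.prob (pair_pmf (vertex_samples n (num_rounds N) (round_size N)) (pair_samples n (num_pairs N)))
    {(U, W). \<bar>estimate (labels (num_classes N)) (edit_cost G) (num_rounds N) (round_size N) (num_pairs N) U W / 2
      - property_dist G (induced_free C4)\<bar> \<le> 1 / real N} \<ge> 2 / 3"
proof -
  define k where "k = num_classes N"
  define b where "b = label_bits N"
  define l where "l = num_rounds N"
  define t where "t = round_size N"
  define m where "m = num_pairs N"
  define x where "x = real N"
  define \<theta> where "\<theta> = 1 / (144 * x)"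
  define e where "e = 1 / (2 * x)"
  let ?d = "property_dist G (induced_free C4)"
  have x: "x \<ge> 1" using N by (simp add: x_def)
  interpret pair_labelling n "labels k" "edit_cost G"
    by (rule pair_labelling_edit_cost[OF n])
  have r: "real (card (labels k)) \<le> exp (real b)"
  proof -
    have "real (card (labels k)) \<le> real (2 ^ b)"
      using card_labels_le[of k] unfolding b_def label_bits_def k_def by (rule of_nat_mono)
    also have "\<dots> = 2 ^ b" by simp
    also have "\<dots> \<le> exp 1 ^ b"
      using exp_ge_add_one_self[of 1] by (intro power_mono) auto
    finally show ?thesis by (simp flip: exp_of_nat_mult)
  qed
  have t\<theta>: "real t * \<theta>\<^sup>2 = real b + 144 * x"
    using x by (simp add: t_def round_size_def \<theta>_def b_def x_def power2_eq_square field_simps)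
  have me: "real m * e\<^sup>2 = real b * (real t * real l) + 12"
    using x by (simp add: m_def num_pairs_def e_def b_def t_def l_def x_def power2_eq_square)
  have small: "4 * \<theta> + 4 * real (card (labels k)) * exp (- 2 * real t * \<theta>\<^sup>2) + 2 / real l \<le> e / 6"
  proof -
    have "real (card (labels k)) * exp (- 2 * (real b + 144 * x)) \<le> exp (real b) * exp (- 2 * (real b + 144 * x))"
      using r by (intro mult_right_mono) auto
    also have "\<dots> = exp (real b + - 2 * (real b + 144 * x))"
      by (simp only: exp_add)
    also have "\<dots> \<le> exp (- (144 * x))"
      using x by simp
    also have "\<dots> = 1 / exp (144 * x)"
      by (simp add: exp_minus field_simps)
    also have "\<dots> \<le> 1 / (144 * x)"
    proof -
      have "144 * x \<le> exp (144 * x)" using exp_ge_add_one_self[of "144 * x"] by linarith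
      then show ?thesis using x by (intro divide_left_mono) auto
    qed
    finally have "real (card (labels k)) * exp (- 2 * real t * \<theta>\<^sup>2) \<le> 1 / (144 * x)"
      by (simp only: mult.assoc t\<theta>)
    moreover have "2 / real l = 1 / (36 * x)" by (simp add: l_def num_rounds_def x_def)
    moreover have "4 * \<theta> = 1 / (36 * x)" by (simp add: \<theta>_def)
    \<comment> \<open>The budget \<open>e / 6 = 1 / (12 * x)\<close> is split into three equal
      shares.\<close>
    moreover have "e / 6 = 1 / (36 * x) + 4 * (1 / (144 * x)) + 1 / (36 * x)"
      using x by (simp add: e_def field_simps)
    ultimately show ?thesis by linarith
  qed
  have many: "real (card (labels k)) ^ (t * l) * (2 * exp (- 2 * real m * e\<^sup>2)) \<le> 1 / 6"
  proof -
    define y where "y = real b * (real t * real l)"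
    have y: "y \<ge> 0" by (simp add: y_def)
    have "real (card (labels k)) ^ (t * l) \<le> exp (real b) ^ (t * l)"
      using r by (intro power_mono) auto
    also have "\<dots> = exp y"
      by (simp add: y_def mult_ac flip: exp_of_nat_mult)
    finally have "real (card (labels k)) ^ (t * l) * (2 * exp (- 2 * (y + 12))) \<le> exp y * (2 * exp (- 2 * (y + 12)))"
      by (intro mult_right_mono) auto
    also have "exp y * (2 * exp (- 2 * (y + 12))) = 2 * exp (y + - 2 * (y + 12))"
      by (simp only: exp_add mult_ac)
    also have "\<dots> \<le> 2 * exp (- 24)"
      using y by simp
    also have "\<dots> \<le> 1 / 6"
    proof -
      have "exp (24 :: real) \<ge> 25" using exp_ge_add_one_self[of "24 :: real"] by linarith
      then show ?thesis by (simp add: exp_minus field_simps)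
    qed
    moreover have "- 2 * real m * e\<^sup>2 = - 2 * (y + 12)"
      using me by (simp only: mult.assoc y_def)
    ultimately show ?thesis by simp
  qed
  obtain f where f: "\<And>v. f v \<in> labels k"
    and opt: "\<And>g. (\<And>v. g v \<in> labels k) \<Longrightarrow> pair_cost n (edit_cost G) f f \<le> pair_cost n (edit_cost G) g g"
    using optimal_labelling_exists by auto
  have lower: "2 * ?d \<le> pair_cost n (edit_cost G) f f"
    using property_dist_le_pair_cost[OF G, of f k] f by simp
  have a: "14 * N > 0" using N by simp
  obtain g where g: "\<And>v. g v \<in> labels k"
    and cost: "pair_cost n (edit_cost G) g g \<le> 2 * ?d + 7 / real (14 * N)"
    by (rule pair_cost_le_property_dist[OF G n a, folded num_classes_def k_def]) (rule that, assumption+)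
  have pos: "l > 0" "t > 0" "m > 0" "\<theta> \<ge> 0" "e > 0"
    using N x by (simp_all add: l_def num_rounds_def t_def round_size_def m_def num_pairs_def
        \<theta>_def e_def label_bits_def)
  have upper: "pair_cost n (edit_cost G) f f \<le> 2 * ?d + 1 / (2 * x)"
    using opt[of g] g cost x by (simp add: x_def)
  have "2 / 3 \<le> measure_pmf.prob (pair_pmf (vertex_samples n l t) (pair_samples n m))
      {(U, W). \<bar>estimate (labels k) (edit_cost G) l t m U W - pair_cost n (edit_cost G) f f\<bar> \<le> 2 * e}"
    by (rule prob_estimate_close[OF f opt pos small many])
  also have "\<dots> \<le> measure_pmf.prob (pair_pmf (vertex_samples n l t) (pair_samples n m))
      {(U, W). \<bar>estimate (labels k) (edit_cost G) l t m U W / 2 - ?d\<bar> \<le> 1 / real N}"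
  proof (rule measure_pmf.finite_measure_mono)
    have "\<bar>z / 2 - ?d\<bar> \<le> 1 / real N" if z: "\<bar>z - pair_cost n (edit_cost G) f f\<bar> \<le> 2 * e" for z
    proof -
      have "2 * e = 1 / x" "1 / (2 * x) = 1 / x / 2" by (simp_all add: e_def)
      moreover have "1 / x \<ge> 0" using x by simp
      ultimately have "z / 2 - ?d \<le> 1 / x" "- (z / 2 - ?d) \<le> 1 / x"
        using abs_le_D1[OF z] abs_le_D2[OF z] lower upper by linarith+
      then show ?thesis unfolding x_def[symmetric] by (rule abs_leI)
    qed
    then show "{(U, W). \<bar>estimate (labels k) (edit_cost G) l t m U W - pair_cost n (edit_cost G) f f\<bar> \<le> 2 * e} \<subseteq>
      {(U, W). \<bar>estimate (labels k) (edit_cost G) l t m U W / 2 - ?d\<bar> \<le> 1 / real N}"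
      by auto
  qed simp
  finally show ?thesis
    unfolding k_def l_def t_def m_def .
qed

section \<open>Bounding the number of queries\<close>

lemma mult_le_exp_add:
  fixes u v x y :: real
  shows "x \<le> exp u \<Longrightarrow> y \<le> exp v \<Longrightarrow> 0 \<le> y \<Longrightarrow> x * y \<le> exp (u + v)"
  unfolding exp_add by (intro mult_mono) auto

lemma add_le_exp_Suc:
  fixes u x y z :: real
  assumes "x \<le> exp u" "y \<le> exp u" "z \<ge> 1"
  shows "x + y \<le> exp (u + z)"
proof -
  have "x + y \<le> 2 * exp u" using assms by simp
  also have "\<dots> \<le> exp z * exp u"
  proof -
    have "2 \<le> exp z" using exp_ge_add_one_self[of z] assms(3) by linarith
    then show ?thesis by (intro mult_right_mono) auto
  qed
  finally show ?thesis by (simp add: exp_add mult.commute)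
qed

lemma power_two_le_exp:
  fixes z :: real
  assumes "z \<ge> 1" "c \<le> 2 ^ j"
  shows "c \<le> exp (real j * z)"
proof -
  have "c \<le> 2 ^ j" by (rule assms(2))
  also have "\<dots> \<le> exp z ^ j"
  proof -
    have "2 \<le> exp z" using exp_ge_add_one_self[of z] assms(1) by linarith
    then show ?thesis by (intro power_mono) auto
  qed
  finally show ?thesis by (simp flip: exp_of_nat_mult)
qed

text \<open>Since \<open>M + 1 \<le> exp M\<close>, the number of classes is at most
  \<open>exp (K * (M + 1))\<close>. Every parameter is therefore at most the exponential of a
  constant multiple of \<open>z\<close>, and \<open>z\<close> is polynomial in
  \<open>N\<close>.\<close>

lemma query_bound:
  assumes N: "N > 0"
  shows "real ((num_rounds N * round_size N + 2 * num_pairs N)\<^sup>2) \<le> exp (12047296900 * real N ^ 6)"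
proof -
  define x where "x = real N"
  define K where "K = 2 * (14 * x)\<^sup>2"
  define M where "M = 8 * (14 * x) ^ 4"
  define z where "z = K * (M + 1) + x"
  define k where "k = real (num_classes N)"
  define b where "b = real (label_bits N)"
  define l where "l = real (num_rounds N)"
  define t where "t = real (round_size N)"
  define m where "m = real (num_pairs N)"
  have x: "x \<ge> 1" using N by (simp add: x_def)
  have K: "K \<ge> 0" and M: "M \<ge> 0" by (simp_all add: K_def M_def)
  have z: "z \<ge> 1" using x K M by (simp add: z_def add_increasing)
  have xz: "x \<le> exp z"
  proof -
    have "x \<le> z" using K M by (simp add: z_def)
    then show ?thesis using exp_ge_add_one_self[of z] by linarith
  qed
  have c: "c \<le> exp (real j * z)" if "c \<le> 2 ^ j" for c j
    using power_two_le_exp[OF z that] .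
  have nonneg: "0 \<le> k" "0 \<le> b" "0 \<le> l" "0 \<le> t" "0 \<le> m" "0 \<le> x"
    using x by (simp_all add: k_def b_def l_def t_def m_def)
  have k: "k \<le> exp z"
  proof -
    have "k = K * (M + 1) ^ (2 * (14 * N)\<^sup>2)"
      by (simp add: k_def num_classes_def K_def M_def x_def add.commute)
    also have "\<dots> \<le> exp K * exp M ^ (2 * (14 * N)\<^sup>2)"
    proof -
      have "K \<le> exp K" "M + 1 \<le> exp M"
        using exp_ge_add_one_self[of K] exp_ge_add_one_self[of M] by linarith+
      then show ?thesis using K M by (intro mult_mono power_mono) auto
    qed
    also have "exp M ^ (2 * (14 * N)\<^sup>2) = exp (K * M)"
      by (simp add: K_def x_def flip: exp_of_nat_mult)
    also have "exp K * exp (K * M) = exp (K * (M + 1))"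
      by (simp add: distrib_left add.commute flip: exp_add)
    also have "\<dots> \<le> exp z" using x by (simp add: z_def)
    finally show ?thesis .
  qed
  have b: "b \<le> exp (4 * z)"
  proof -
    have "k * k \<le> exp (z + z)" using k nonneg by (intro mult_le_exp_add)
    then have 1: "k * k \<le> exp (2 * z)" by simp
    have "k \<le> exp (2 * z)" using order_trans[OF k, of "exp (2 * z)"] z by simp
    with 1 have 2: "k * k + k \<le> exp (2 * z + z)" using z by (intro add_le_exp_Suc)
    have "1 \<le> exp (2 * z + z)" using z by simp
    from add_le_exp_Suc[OF 2 this z] show ?thesis by (simp add: b_def label_bits_def k_def)
  qed
  have x144: "144 * x \<le> exp (9 * z)"
    using mult_le_exp_add[OF c[of 144 8] xz nonneg(6)] by simp
  have l: "l \<le> exp (8 * z)"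
    using mult_le_exp_add[OF c[of 72 7] xz nonneg(6)] by (simp add: l_def num_rounds_def x_def)
  have t: "t \<le> exp (28 * z)"
  proof -
    have "b \<le> exp (9 * z)" using order_trans[OF b, of "exp (9 * z)"] z by simp
    then have 1: "b + 144 * x \<le> exp (9 * z + z)" using x144 z by (intro add_le_exp_Suc)
    have 2: "(144 * x) * (144 * x) \<le> exp (9 * z + 9 * z)" using x144 nonneg by (intro mult_le_exp_add) auto
    have "(144 * x) * (144 * x) * (b + 144 * x) \<le> exp (9 * z + 9 * z + (9 * z + z))"
      using nonneg by (intro mult_le_exp_add[OF 2 1]) auto
    then show ?thesis
      by (simp add: t_def round_size_def b_def x_def power2_eq_square)
  qed
  have m: "m \<le> exp (48 * z)"
  proof -
    have "t * l \<le> exp (28 * z + 8 * z)" using t l nonneg by (intro mult_le_exp_add)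
    then have "b * (t * l) \<le> exp (4 * z + (28 * z + 8 * z))"
      using nonneg by (intro mult_le_exp_add[OF b]) auto
    moreover have "12 \<le> exp (4 * z + (28 * z + 8 * z))" using c[of 12 40] by simp
    ultimately have 1: "b * (t * l) + 12 \<le> exp (4 * z + (28 * z + 8 * z) + z)"
      using z by (intro add_le_exp_Suc)
    have "x * x \<le> exp (z + z)" using xz nonneg by (intro mult_le_exp_add)
    then have "4 * (x * x) \<le> exp (real 2 * z + (z + z))"
      using nonneg by (intro mult_le_exp_add[OF c[of 4 2]]) auto
    then have "4 * (x * x) * (b * (t * l) + 12) \<le> exp (real 2 * z + (z + z) + (4 * z + (28 * z + 8 * z) + z))"
      using nonneg by (intro mult_le_exp_add[OF \<open>4 * (x * x) \<le> _\<close> 1]) auto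
    also have "\<dots> \<le> exp (48 * z)" using z by simp
    finally show ?thesis
      by (simp add: m_def num_pairs_def b_def t_def l_def x_def power2_eq_square)
  qed
  have "l * t \<le> exp (8 * z + 28 * z)" using l t nonneg by (intro mult_le_exp_add)
  also have "\<dots> \<le> exp (49 * z)" using z by simp
  finally have 1: "l * t \<le> exp (49 * z)" .
  have "2 * m \<le> exp (real 1 * z + 48 * z)"
    using m nonneg by (intro mult_le_exp_add[OF c]) auto
  then have 2: "2 * m \<le> exp (49 * z)" by simp
  have "l * t + 2 * m \<le> exp (49 * z + z)"
    using 1 2 z by (intro add_le_exp_Suc)
  then have "(l * t + 2 * m) * (l * t + 2 * m) \<le> exp ((49 * z + z) + (49 * z + z))"
    using nonneg by (intro mult_le_exp_add) auto
  also have "\<dots> = exp (100 * z)" by simp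
  also have "\<dots> \<le> exp (12047296900 * x ^ 6)"
  proof -
    have p: "x ^ j \<le> x ^ 6" if "j \<le> 6" for j
      using x that by (intro power_increasing)
    \<comment> \<open>The leading coefficient is that of \<open>K * M\<close>, namely
      \<open>2 * 14 ^ 2 * 8 * 14 ^ 4\<close>. Adding up all three coefficients and multiplying by
      100 gives the constant of the lemma.\<close>
    have "z = 120472576 * x ^ 6 + 392 * x\<^sup>2 + x"
      by (simp add: z_def K_def M_def power_mult_distrib algebra_simps flip: power_add)
    also have "\<dots> \<le> 120472969 * x ^ 6"
      using p[of 2] p[of 1] by simp
    finally show ?thesis by simp
  qed
  finally show ?thesis
    by (simp add: l_def t_def m_def x_def power2_eq_square)
qed

text \<open>For \<open>n = 0\<close> there is nothing to sample from, and the distance is \<open>0 / 0 = 0\<close>.\<close>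

definition C4_distance_algorithm :: randomized_algorithm where
  "C4_distance_algorithm n \<epsilon> = (if n = 0 then return_pmf (Output 0) else
     let N = nat \<lceil>1 / \<epsilon>\<rceil>; k = num_classes N; l = num_rounds N; t = round_size N; m = num_pairs N
     in map_pmf (\<lambda>(U, W). estimate_tree k l t m U W) (pair_pmf (vertex_samples n l t) (pair_samples n m)))"

lemma property_dist_empty:
  assumes "simple_graph G" "verts G = {}"
  shows "property_dist G (induced_free C4) = 0"
proof -
  let ?S = "{graph_dist G H |H. H \<in> induced_free C4 \<and> simple_graph H \<and> verts H = verts G}"
  have "({}, {}) \<in> induced_free C4" by (rule edgeless_induced_C4_free) simp
  moreover have "simple_graph ({}, {})" by (simp add: simple_graph_def)
  ultimately have "?S \<noteq> {}" using assms(2) by fastforce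
  moreover have "?S \<subseteq> {0}" using assms(2) by (auto simp: graph_dist_def)
  ultimately have "?S = {0}" by (meson subset_singletonD)
  then show ?thesis by (simp add: property_dist_def)
qed

theorem theorem1p5:
  "\<exists>(A :: randomized_algorithm) (p :: real poly).
     distance_approximation_algorithm A (induced_free C4) \<and>
     query_complexity_le A (\<lambda>\<epsilon>. exp (poly p (1 / \<epsilon>)))"
proof (intro exI conjI)
  show "distance_approximation_algorithm C4_distance_algorithm (induced_free C4)"
    unfolding distance_approximation_algorithm_def
  proof (intro allI impI, elim conjE)
    fix n :: nat and G :: "nat ugraph" and \<epsilon> :: real
    assume G: "simple_graph G" "verts G = {..<n}" and \<epsilon>: "0 < \<epsilon>" "\<epsilon> < 1"
    define N where "N = nat \<lceil>1 / \<epsilon>\<rceil>"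
    have N: "N > 0" "1 / \<epsilon> \<le> real N"
      using \<epsilon> by (simp_all add: N_def)
    then have N\<epsilon>: "1 / real N \<le> \<epsilon>" using \<epsilon> by (simp add: field_simps)
    show "2 / 3 \<le> measure_pmf.prob (C4_distance_algorithm n \<epsilon>)
        {t. \<bar>run_tree t G - property_dist G (induced_free C4)\<bar> \<le> \<epsilon>}"
    proof (cases "n = 0")
      case True
      then show ?thesis
        using property_dist_empty[OF G(1)] G(2) \<epsilon> by (simp add: C4_distance_algorithm_def)
    next
      case False
      let ?S = "pair_pmf (vertex_samples n (num_rounds N) (round_size N)) (pair_samples n (num_pairs N))"
      have "2 / 3 \<le> measure_pmf.prob ?S {(U, W). \<bar>estimate (labels (num_classes N)) (edit_cost G)
          (num_rounds N) (round_size N) (num_pairs N) U W / 2 - property_dist G (induced_free C4)\<bar> \<le> 1 / real N}"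
        using prob_estimate_property_dist[OF G _ N(1)] False by simp
      also have "\<dots> \<le> measure_pmf.prob ?S {(U, W). \<bar>run_tree (estimate_tree (num_classes N)
          (num_rounds N) (round_size N) (num_pairs N) U W) G - property_dist G (induced_free C4)\<bar> \<le> \<epsilon>}"
        using N\<epsilon> by (intro measure_pmf.finite_measure_mono) (auto simp: run_estimate_tree)
      also have "\<dots> = measure_pmf.prob (C4_distance_algorithm n \<epsilon>)
          {t. \<bar>run_tree t G - property_dist G (induced_free C4)\<bar> \<le> \<epsilon>}"
        using False by (simp add: C4_distance_algorithm_def Let_def N_def[symmetric] vimage_def case_prod_unfold)
      finally show ?thesis .
    qed
  qed
  \<comment> \<open>The factor 64 is \<open>2 ^ 6\<close>: rounding \<open>1 / \<epsilon>\<close> up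
    to \<open>N\<close> at most doubles it.\<close>
  let ?p = "monom (12047296900 * 64) 6 :: real poly"
  show "query_complexity_le C4_distance_algorithm (\<lambda>\<epsilon>. exp (poly ?p (1 / \<epsilon>)))"
    unfolding query_complexity_le_def
  proof (intro allI impI ballI, elim conjE)
    fix \<epsilon> :: real and n :: nat and G :: "nat ugraph" and t
    assume \<epsilon>: "0 < \<epsilon>" "\<epsilon> < 1" and t: "t \<in> set_pmf (C4_distance_algorithm n \<epsilon>)"
    define N where "N = nat \<lceil>1 / \<epsilon>\<rceil>"
    have N: "N > 0" using \<epsilon> by (simp add: N_def)
    have "1 / \<epsilon> \<ge> 1" using \<epsilon> by simp
    then have N2: "real N \<le> 2 * (1 / \<epsilon>)"
      unfolding N_def by linarith
    show "real (num_queries t G) \<le> exp (poly ?p (1 / \<epsilon>))"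
    proof (cases "n = 0")
      case True
      then show ?thesis using t by (simp add: C4_distance_algorithm_def)
    next
      case False
      then have "num_queries t G = (num_rounds N * round_size N + 2 * num_pairs N)\<^sup>2"
        using t by (auto simp: C4_distance_algorithm_def Let_def N_def[symmetric] num_queries_estimate_tree)
      then have "real (num_queries t G) \<le> exp (12047296900 * real N ^ 6)"
        using query_bound[OF N] by simp
      also have "\<dots> \<le> exp (12047296900 * (2 * (1 / \<epsilon>)) ^ 6)"
        using N2 by (simp only: exp_le_cancel_iff) (intro mult_left_mono power_mono, auto)
      also have "\<dots> = exp (poly ?p (1 / \<epsilon>))"
        by (simp add: poly_monom power_divide)
      finally show ?thesis .
    qed
  qed
qed

end
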